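(* Consider the network with one base station, $n$ CUEs, $m$ D2D pairs and one eavesdropper described in the context, with mode selection probability $p$, spectrum partition factor $\beta\in[0,1]$ and target rate $r_t$. Put $\varepsilon=\frac pn$ and $\vartheta=p\left(1-\frac1n\right)$. Fix $j\in\{1,\dots,m\}$, let $\mathcal D'=\mathcal D\setminus\{D_j\}$ and write $\gamma_j=\gamma_{D_j^t,D_j^r}$. Then the outage probability of D2D pair $D_j$ is $$\mathbf P_o^j=1-\sum_{l=1}^m\binom{m-1}{l-1}p^{m-l}(1-p)^l\exp\left(-\frac{2^{lr_t/(1-\beta)}-1}{\gamma_j}\right)$$ $$-\sum_{i=1}^n\ \sum_{\mathbf D\in 2^{\mathcal D'}}\varepsilon^{|\mathbf D|+1}\left[\vartheta^{m-1-|\mathbf D|}\Omega_{i,j}(\mathbf D,1)+\left((1-\varepsilon)^{m-1-|\mathbf D|}-\vartheta^{m-1-|\mathbf D|}\right)\Omega_{i,j}(\mathbf D,\beta)\right],$$ where $$\Omega_{i,j}(\mathbf D,\beta)=\frac{\exp\left(-\frac{2^{nr_t/\beta}-1}{\gamma_j}\right)}{\frac{\gamma_{A_i,D_j^r}}{\gamma_j}\left(2^{nr_t/\beta}-1\right)+1}$$ if $\mathbf D=\emptyset$; otherwise $$\Omega_{i,j}(\mathbf D,\beta)=\frac{\int_0^\infty \exp\left(-\frac{(2^{nr_t/\beta}-1)(x+1)}{\gamma_j}\right)\mathbf h^j_{\mathbf D}(x)\,\mathrm dx}{\frac{\gamma_{A_i,D_j^r}}{\gamma_j}\left(2^{nr_t/\beta}-1\right)+1}.$$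 The average capacity of $D_j$ is $$\mathbf R_j=\sum_{i=1}^n\ \sum_{\mathbf D\in2^{\mathcal D'}}\frac{\varepsilon^{|\mathbf D|+1}\Delta_{i,j}(\mathbf D)\left[\beta(1-\varepsilon)^{m-1-|\mathbf D|}+(1-\beta)\vartheta^{m-1-|\mathbf D|}\right]}{n\ln2\left(\frac{\gamma_{A_i,D_j^r}}{\gamma_j}-1\right)}-\frac{(1-\beta)\Psi\left(\frac1{\gamma_j}\right)}{\ln 2}\sum_{l=1}^m\binom{m-1}{l-1}\frac{p^{m-l}(1-p)^l}{l},$$ where $$\Delta_{i,j}(\mathbf D)=\Psi\left(\frac1{\gamma_j}\right)-\Psi\left(\frac1{\gamma_{A_i,D_j^r}}\right)$$ if $\mathbf D=\emptyset$; otherwise $$\Delta_{i,j}(\mathbf D)=\int_0^\infty\mathbf h^j_{\mathbf D}(x)\left[\Psi\left(\frac{x+1}{\gamma_j}\right)-\Psi\left(\frac{x+1}{\gamma_{A_i,D_j^r}}\right)\right]\mathrm dx.$$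
   Context: Network: a base station $B$, an eavesdropper $E$, cellular users (CUEs) $A_1,\dots,A_n$, and a set $\mathcal D=\{D_1,\dots,D_m\}$ of D2D pairs, $D_j$ having transmitter $D_j^t$ and receiver $D_j^r$. For a transmitting node $a$ and a receiving node $b$, $\mathrm{SNR}_{a,b}$ is an exponentially distributed random variable with mean $\gamma_{a,b}$; these random variables (for different pairs $(a,b)$) are independent. Mode selection: each D2D pair independently and randomly operates in underlay mode with probability $p$ and in overlay mode with probability $1-p$; each underlay pair reuses the spectrum of exactly one CUE, chosen independently and with equal probability $1/n$ among the $n$ CUEs. $\mathcal D_o$ is the random set of overlay pairs and $\mathcal D_u^i$ the random set of underlay pairs reusing the spectrum of $A_i$. Spectrum partition (total bandwidth $1$): a fraction $\tilde\beta$ of the spectrum is shared equally among the $n$ CUEs and the remaining fraction equally among the overlay pairs, where $\tilde\beta=\beta$ if $\mathcal D_o\neq\emptyset$ and $\tilde\beta=1$ if $\mathcal D_o=\emptyset$. Capacities of $D_j$: when $D_j$ is underlay and reuses the spectrum of $A_i$, $$R_u^{j,i}=\frac{\tilde\beta}{n}\log_2\left(1+\frac{\mathrm{SNR}_{D_j^t,D_j^r}}{\mathrm{SNR}_{A_i,D_j^r}+\sum_{D_k\in\mathcal D_u^i\setminus\{D_j\}}\mathrm{SNR}_{D_k^t,D_j^r}+1}\right);$$ when $D_j$ is overlay, $$R_o^j=\frac{1-\beta}{|\mathcal D_o|}\log_2\left(1+\mathrm{SNR}_{D_j^t,D_j^r}\right).$$ The outage probability and the average capacity of $D_j$ are $$\mathbf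 P_o^j=\frac pn\sum_{i=1}^n\mathbb P(R_u^{j,i}<r_t)+(1-p)\mathbb P(R_o^j<r_t),\qquad \mathbf R_j=\frac pn\sum_{i=1}^n\mathbb E[R_u^{j,i}]+(1-p)\mathbb E[R_o^j],$$ where $\mathbb P(R_u^{j,i}<r_t)$, $\mathbb E[R_u^{j,i}]$ refer to $D_j$ operating in underlay mode and reusing the spectrum of $A_i$, and $\mathbb P(R_o^j<r_t)$, $\mathbb E[R_o^j]$ to $D_j$ operating in overlay mode (the other $m-1$ pairs choosing as described). Notation: $2^{\mathcal D'}$ is the power set of $\mathcal D'$. For nonempty $\mathbf D\subseteq\mathcal D'$, $\mathbf h^j_{\mathbf D}$ is the probability density function of $\sum_{D_k\in\mathbf D}\mathrm{SNR}_{D_k^t,D_j^r}$ (the convolution of the densities of the summands). $\Psi(x)=e^x\mathrm{Ei}(-x)$, where $\mathrm{Ei}(x)=-\int_{-x}^\infty\frac{e^{-t}}t\,\mathrm dt$ is the exponential integral. *)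

theory Defs
  imports "HOL-Probability.Probability"
begin

section \<open>Network model\<close>

text \<open>
  The CUEs are indexed by \<open>1, \<dots>, n\<close> and the D2D pairs by \<open>1, \<dots>, m\<close>; the pair \<open>j\<close> consists
  of the transmitter \<open>D2D_Tx j\<close> and the receiver \<open>D2D_Rx j\<close>.
\<close>

datatype transmitter = CUE nat | D2D_Tx nat

datatype receiver = Base_Station | Eavesdropper | D2D_Rx nat

datatype d2d_mode = Overlay | Underlay nat

definition transmitters :: "nat \<Rightarrow> nat \<Rightarrow> transmitter set" where
  "transmitters n m = CUE ` {1..n} \<union> D2D_Tx ` {1..m}"

definition receivers :: "nat \<Rightarrow> receiver set" where
  "receivers m = {Base_Station, Eavesdropper} \<union> D2D_Rx ` {1..m}"

definition mode_pmf :: "nat \<Rightarrow> real \<Rightarrow> d2d_mode pmf" where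
  "mode_pmf n p =
     bind_pmf (bernoulli_pmf p)
       (\<lambda>u. if u then map_pmf Underlay (pmf_of_set {1..n}) else return_pmf Overlay)"

text \<open>
  \<open>\<gamma> a b\<close> is the mean of \<open>SNR a b\<close>, so its rate is \<open>1 / \<gamma> a b\<close>. The assumption \<open>indep\<close> is
  the mutual independence of all the SNRs and all the mode selections. It is stated for the generated
  families of events because \<open>indep_vars\<close> needs one common value type.
\<close>

locale d2d_network = prob_space M
  for M :: "'a measure" +
  fixes n m :: nat
    and p :: real
    and \<gamma> :: "transmitter \<Rightarrow> receiver \<Rightarrow> real"
    and SNR :: "transmitter \<Rightarrow> receiver \<Rightarrow> 'a \<Rightarrow> real"
    and mode :: "nat \<Rightarrow> 'a \<Rightarrow> d2d_mode"
  assumes n_pos: "n \<ge> 1"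
    and p_nonneg: "0 \<le> p"
    and p_le_1: "p \<le> 1"
    and mean_pos: "\<And>a b. a \<in> transmitters n m \<Longrightarrow> b \<in> receivers m \<Longrightarrow> \<gamma> a b > 0"
    and SNR_exponential: "\<And>a b. a \<in> transmitters n m \<Longrightarrow> b \<in> receivers m \<Longrightarrow>
          distributed M lborel (SNR a b) (exponential_density (1 / \<gamma> a b))"
    and mode_measurable: "\<And>k. k \<in> {1..m} \<Longrightarrow> mode k \<in> measurable M (count_space UNIV)"
    and mode_distribution: "\<And>k. k \<in> {1..m} \<Longrightarrow>
          distr M (count_space UNIV) (mode k) = measure_pmf (mode_pmf n p)"
    and indep: "indep_sets
          (case_sum
            (\<lambda>(a, b). {SNR a b -` A \<inter> space M | A. A \<in> sets borel})
            (\<lambda>k. {mode k -` A \<inter> space M | A. A \<in> UNIV}))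
          ((transmitters n m \<times> receivers m) <+> {1..m})"

definition overlay_set :: "nat \<Rightarrow> (nat \<Rightarrow> 'a \<Rightarrow> d2d_mode) \<Rightarrow> 'a \<Rightarrow> nat set" where
  "overlay_set m mode \<omega> = {k \<in> {1..m}. mode k \<omega> = Overlay}"

definition underlay_set :: "nat \<Rightarrow> (nat \<Rightarrow> 'a \<Rightarrow> d2d_mode) \<Rightarrow> nat \<Rightarrow> 'a \<Rightarrow> nat set" where
  "underlay_set m mode i \<omega> = {k \<in> {1..m}. mode k \<omega> = Underlay i}"

definition cue_fraction :: "nat \<Rightarrow> real \<Rightarrow> (nat \<Rightarrow> 'a \<Rightarrow> d2d_mode) \<Rightarrow> 'a \<Rightarrow> real" where
  "cue_fraction m \<beta> mode \<omega> = (if overlay_set m mode \<omega> \<noteq> {} then \<beta> else 1)"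

definition underlay_capacity ::
  "nat \<Rightarrow> nat \<Rightarrow> real \<Rightarrow> (transmitter \<Rightarrow> receiver \<Rightarrow> 'a \<Rightarrow> real) \<Rightarrow> (nat \<Rightarrow> 'a \<Rightarrow> d2d_mode)
    \<Rightarrow> nat \<Rightarrow> nat \<Rightarrow> 'a \<Rightarrow> real" where
  "underlay_capacity n m \<beta> SNR mode j i \<omega> =
     cue_fraction m \<beta> mode \<omega> / real n *
     log 2 (1 + SNR (D2D_Tx j) (D2D_Rx j) \<omega> /
       (SNR (CUE i) (D2D_Rx j) \<omega>
        + (\<Sum>k\<in>underlay_set m mode i \<omega> - {j}. SNR (D2D_Tx k) (D2D_Rx j) \<omega>) + 1))"

definition overlay_capacity ::
  "nat \<Rightarrow> real \<Rightarrow> (transmitter \<Rightarrow> receiver \<Rightarrow> 'a \<Rightarrow> real) \<Rightarrow> (nat \<Rightarrow> 'a \<Rightarrow> d2d_mode)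
    \<Rightarrow> nat \<Rightarrow> 'a \<Rightarrow> real" where
  "overlay_capacity m \<beta> SNR mode j \<omega> =
     (1 - \<beta>) / real (card (overlay_set m mode \<omega>)) * log 2 (1 + SNR (D2D_Tx j) (D2D_Rx j) \<omega>)"

text \<open>
  The conditional law given that pair \<open>j\<close> operates in mode \<open>c\<close>. When that event is null
  (\<open>p = 0\<close> or \<open>p = 1\<close>) this is the zero measure, and below it only occurs with
  weight \<open>p / n = 0\<close> or \<open>1 - p = 0\<close>.
\<close>

definition given_mode ::
  "'a measure \<Rightarrow> (nat \<Rightarrow> 'a \<Rightarrow> d2d_mode) \<Rightarrow> nat \<Rightarrow> d2d_mode \<Rightarrow> 'a measure" where
  "given_mode M mode j c = uniform_measure M {\<omega> \<in> space M. mode j \<omega> = c}"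

definition outage_probability ::
  "'a measure \<Rightarrow> nat \<Rightarrow> nat \<Rightarrow> real \<Rightarrow> real \<Rightarrow> real
    \<Rightarrow> (transmitter \<Rightarrow> receiver \<Rightarrow> 'a \<Rightarrow> real) \<Rightarrow> (nat \<Rightarrow> 'a \<Rightarrow> d2d_mode) \<Rightarrow> nat \<Rightarrow> real" where
  "outage_probability M n m p \<beta> r SNR mode j =
     p / real n * (\<Sum>i=1..n. measure (given_mode M mode j (Underlay i))
                       {\<omega> \<in> space M. underlay_capacity n m \<beta> SNR mode j i \<omega> < r})
     + (1 - p) * measure (given_mode M mode j Overlay)
                       {\<omega> \<in> space M. overlay_capacity m \<beta> SNR mode j \<omega> < r}"

definition average_capacity ::
  "'a measure \<Rightarrow> nat \<Rightarrow> nat \<Rightarrow> real \<Rightarrow> real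
    \<Rightarrow> (transmitter \<Rightarrow> receiver \<Rightarrow> 'a \<Rightarrow> real) \<Rightarrow> (nat \<Rightarrow> 'a \<Rightarrow> d2d_mode) \<Rightarrow> nat \<Rightarrow> real" where
  "average_capacity M n m p \<beta> SNR mode j =
     p / real n * (\<Sum>i=1..n. integral\<^sup>L (given_mode M mode j (Underlay i))
                       (underlay_capacity n m \<beta> SNR mode j i))
     + (1 - p) * integral\<^sup>L (given_mode M mode j Overlay) (overlay_capacity m \<beta> SNR mode j)"

section \<open>Quantities in the closed forms\<close>

text \<open>Only meaningful for negative arguments, where the integral converges.\<close>

definition Ei :: "real \<Rightarrow> real" where
  "Ei x = - (LBINT t:{-x..}. exp (- t) / t)"

definition Psi :: "real \<Rightarrow> real" where
  "Psi x = exp x * Ei (- x)"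

fun convolve :: "(real \<Rightarrow> real) list \<Rightarrow> real \<Rightarrow> real" where
  "convolve [] x = 0"
| "convolve [f] x = f x"
| "convolve (f # g # fs) x = (LBINT y. f (x - y) * convolve (g # fs) y)"

text \<open>
  The density of the sum of the interfering SNRs at receiver \<open>j\<close> from the (nonempty) set \<open>D\<close> of
  pairs; see \<open>interference_density\<close> below.
\<close>

definition interf_density ::
  "(transmitter \<Rightarrow> receiver \<Rightarrow> real) \<Rightarrow> nat \<Rightarrow> nat set \<Rightarrow> real \<Rightarrow> real" where
  "interf_density \<gamma> j D =
     convolve (map (\<lambda>k. exponential_density (1 / \<gamma> (D2D_Tx k) (D2D_Rx j))) (sorted_list_of_set D))"

text \<open>
  \<open>exp (- (2 powr (s / c) - 1) / g)\<close>, with its limiting value \<open>0\<close> when no spectrum is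
  available (\<open>c = 0\<close>) and \<open>s > 0\<close>, i.e. \<open>2 powr (s / c)\<close> is read as infinity; HOL's \<open>s / 0 = 0\<close>
  would give \<open>1\<close>. The same reading is used for \<open>\<beta> = 0\<close> in \<open>Omega\<close>.
\<close>

definition exp_threshold :: "real \<Rightarrow> real \<Rightarrow> real \<Rightarrow> real" where
  "exp_threshold s c g = (if c = 0 \<and> s > 0 then 0 else exp (- (2 powr (s / c) - 1) / g))"

definition Omega ::
  "nat \<Rightarrow> real \<Rightarrow> (transmitter \<Rightarrow> receiver \<Rightarrow> real) \<Rightarrow> nat \<Rightarrow> nat \<Rightarrow> nat set \<Rightarrow> real \<Rightarrow> real" where
  "Omega n r \<gamma> i j D \<beta> =
     (let g = \<gamma> (D2D_Tx j) (D2D_Rx j);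
          \<tau> = 2 powr (real n * r / \<beta>) - 1;
          d = \<gamma> (CUE i) (D2D_Rx j) / g * \<tau> + 1
      in if \<beta> = 0 \<and> r > 0 then 0
         else if D = {} then exp (- \<tau> / g) / d
         else (LBINT x:{0..}. exp (- (\<tau> * (x + 1)) / g) * interf_density \<gamma> j D x) / d)"

definition Delta ::
  "(transmitter \<Rightarrow> receiver \<Rightarrow> real) \<Rightarrow> nat \<Rightarrow> nat \<Rightarrow> nat set \<Rightarrow> real" where
  "Delta \<gamma> i j D =
     (let g = \<gamma> (D2D_Tx j) (D2D_Rx j);
          a = \<gamma> (CUE i) (D2D_Rx j)
      in if D = {} then Psi (1 / g) - Psi (1 / a)
         else (LBINT x:{0..}. interf_density \<gamma> j D x * (Psi ((x + 1) / g) - Psi ((x + 1) / a))))"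

section \<open>The iterated convolution is the density of the interference\<close>

lemma (in prob_space) convolve_exponential:
  assumes "ks \<noteq> []" "distinct ks"
    and "indep_vars (\<lambda>_. borel) X (set ks)"
    and "\<And>k. k \<in> set ks \<Longrightarrow> l k > 0"
    and "\<And>k. k \<in> set ks \<Longrightarrow> distributed M lborel (X k) (exponential_density (l k))"
  shows "distributed M lborel (\<lambda>\<omega>. \<Sum>k\<in>set ks. X k \<omega>)
           (convolve (map (\<lambda>k. exponential_density (l k)) ks))
         \<and> (\<forall>x. convolve (map (\<lambda>k. exponential_density (l k)) ks) x \<ge> 0)
         \<and> convolve (map (\<lambda>k. exponential_density (l k)) ks) \<in> borel_measurable borel"
  using assms
proof (induction ks)
  case Nil
  then show ?case by simp
next
  case (Cons k ks)
  let ?e = "\<lambda>k. exponential_density (l k)"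
  have lk: "l k > 0" using Cons.prems by simp
  show ?case
  proof (cases ks)
    case Nil
    have c: "convolve (map ?e (k # ks)) = ?e k"
      by (rule ext) (simp add: Nil)
    have 1: "distributed M lborel (X k) (?e k)"
      using Cons.prems by simp
    show ?thesis
      unfolding c using 1 lk by (simp add: Nil)
  next
    case (Cons k' ks')
    let ?g = "convolve (map ?e ks)"
    let ?c = "convolve (map ?e (k # ks))"
    have IH: "distributed M lborel (\<lambda>\<omega>. \<Sum>k\<in>set ks. X k \<omega>) ?g"
        "\<And>x. ?g x \<ge> 0" and mg [measurable]: "?g \<in> borel_measurable borel"
      using Cons.IH Cons.prems indep_vars_subset[OF Cons.prems(3), of "set ks"]
      by (auto simp: Cons)
    have c: "?c = (\<lambda>x. LBINT y. ?e k (x - y) * ?g y)"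
      by (rule ext) (simp add: Cons)
    have "prob_space (density lborel (\<lambda>x. ennreal (?g x)))"
      unfolding distributed_distr_eq_density[OF IH(1), symmetric]
      by (rule prob_space_distr) (rule distributed_measurable[OF IH(1)])
    then have "(\<integral>\<^sup>+x. ennreal (?g x) \<partial>lborel) = 1"
      by (simp add: prob_space_def prob_space_axioms_def emeasure_density)
    then have ig: "integrable lborel ?g"
      by (intro integrableI_nonneg) (auto simp: IH(2))
    have int: "integrable lborel (\<lambda>y. ?e k (x - y) * ?g y)" for x
    proof (rule Bochner_Integration.integrable_bound[where f = "\<lambda>y. l k * ?g y"])
      show "AE y in lborel. norm (?e k (x - y) * ?g y) \<le> norm (l k * ?g y)"
      proof (rule AE_I2)
        fix y
        have "\<bar>?e k (x - y)\<bar> \<le> l k"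
          using lk by (auto simp: exponential_density_def abs_mult mult_nonpos_nonneg)
        then show "norm (?e k (x - y) * ?g y) \<le> norm (l k * ?g y)"
          using lk by (simp add: abs_mult mult_right_mono)
      qed
    qed (use ig in auto)
    have eq: "(\<integral>\<^sup>+y. ennreal (?e k (x - y)) * ennreal (?g y) \<partial>lborel) = ennreal (?c x)" for x
      unfolding c using int[of x] lk IH(2)
      by (subst nn_integral_eq_integral[symmetric])
         (auto simp: ennreal_mult' intro!: nn_integral_cong)
    have "indep_var borel (X k) borel (\<lambda>\<omega>. \<Sum>k\<in>set ks. X k \<omega>)"
      using Cons.prems by (intro indep_vars_sum) auto
    from distributed_convolution[OF this Cons.prems(5) IH(1)]
    have "distributed M lborel (\<lambda>\<omega>. X k \<omega> + (\<Sum>k\<in>set ks. X k \<omega>)) (\<lambda>x. ennreal (?c x))"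
      by (simp only: eq list.set_intros)
    moreover have "(\<lambda>\<omega>. X k \<omega> + (\<Sum>k\<in>set ks. X k \<omega>)) = (\<lambda>\<omega>. \<Sum>k\<in>set (k # ks). X k \<omega>)"
      using Cons.prems(2) by simp
    moreover have "\<forall>x. ?c x \<ge> 0"
      unfolding c using lk IH(2) by (auto intro!: integral_nonneg_AE)
    moreover have "?c \<in> borel_measurable borel"
      unfolding c by measurable
    ultimately show ?thesis by metis
  qed
qed

lemma (in d2d_network) interference_density:
  assumes j: "j \<in> {1..m}" and D: "D \<subseteq> {1..m}" "D \<noteq> {}"
  shows "distributed M lborel (\<lambda>\<omega>. \<Sum>k\<in>D. SNR (D2D_Tx k) (D2D_Rx j) \<omega>) (interf_density \<gamma> j D)"
proof -
  have fin: "finite D" using D finite_subset by blast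
  let ?X = "\<lambda>k. SNR (D2D_Tx k) (D2D_Rx j)"
  let ?E = "case_sum (\<lambda>(a, b). {SNR a b -` A \<inter> space M | A. A \<in> sets borel})
              (\<lambda>k. {mode k -` A \<inter> space M | A. A \<in> UNIV})"
  have mem: "D2D_Tx k \<in> transmitters n m" "D2D_Rx j \<in> receivers m" if "k \<in> D" for k
    using that D j by (auto simp: transmitters_def receivers_def)
  have dist: "distributed M lborel (?X k) (exponential_density (1 / \<gamma> (D2D_Tx k) (D2D_Rx j)))"
    if "k \<in> D" for k
    using SNR_exponential mem that by blast
  let ?h = "\<lambda>k::nat. Inl (D2D_Tx k, D2D_Rx j) :: (transmitter \<times> receiver) + nat"
  have "indep_vars (\<lambda>_. borel) ?X D"
    unfolding indep_vars_def2
  proof (intro conjI ballI)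
    show "random_variable borel (?X k)" if "k \<in> D" for k
      using distributed_measurable[OF dist[OF that]] by simp
    show "indep_sets (\<lambda>k. {?X k -` A \<inter> space M | A. A \<in> sets borel}) D"
    proof (rule indep_setsI)
      show "{?X k -` A \<inter> space M | A. A \<in> sets borel} \<subseteq> events" if "k \<in> D" for k
        using distributed_measurable[OF dist[OF that]] by (auto intro: measurable_sets)
    next
      fix A J
      assume J: "J \<noteq> {}" "J \<subseteq> D" "finite J"
        and A: "\<forall>k\<in>J. A k \<in> {?X k -` B \<inter> space M | B. B \<in> sets borel}"
      define A' :: "(transmitter \<times> receiver) + nat \<Rightarrow> 'a set" where "A' = case_sum (\<lambda>(a, b). A (case a of D2D_Tx k \<Rightarrow> k | CUE k \<Rightarrow> k)) (\<lambda>k::nat. A k)"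
      have inj: "inj_on ?h J" by (rule inj_onI) simp
      have "prob (\<Inter>x\<in>?h ` J. A' x) = (\<Prod>x\<in>?h ` J. prob (A' x))"
      proof (rule indep_setsD[OF indep])
        show "?h ` J \<subseteq> (transmitters n m \<times> receivers m) <+> {1..m}"
          using mem J by auto
        show "\<forall>x\<in>?h ` J. A' x \<in> ?E x"
          using A by (auto simp: A'_def)
      qed (use J in auto)
      then show "prob (\<Inter>k\<in>J. A k) = (\<Prod>k\<in>J. prob (A k))"
        by (simp add: prod.reindex[OF inj] A'_def)
    qed
  qed
  then show ?thesis
    unfolding interf_density_def
    using convolve_exponential[of "sorted_list_of_set D" ?X "\<lambda>k. 1 / \<gamma> (D2D_Tx k) (D2D_Rx j)"]
      fin D dist mean_pos mem
    by auto
qed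

end

theory Submission
  imports Defs
begin

text \<open>
  Fix the set \<open>D\<close> of interferers sharing the CUE spectrum, let \<open>X\<close>, \<open>Y\<close>, \<open>S\<close> be the SNRs of the pair
  itself, of the CUE and of the interferers, and put \<open>W = Y + S + 1\<close>. Conditioning on \<open>W\<close> gives
  \<open>P (X \<ge> v W) = E exp (- v W / g)\<close>, and the factor coming from \<open>Y\<close> is \<open>1 / (1 + v a / g)\<close>; with
  \<open>v\<close> the threshold this is the outage term. Integrating the same identity against
  \<open>1 / (1 + v)\<close> gives \<open>E ln (1 + X / W)\<close>, which partial fractions in \<open>v\<close> turn into a difference of
  values of \<open>Psi\<close>. It remains to average over the mode configurations, which are independent of
  the SNRs; that an overlay pair exists is handled by inclusion-exclusion.
\<close>

section \<open>Integral representation of \<open>Psi\<close> and exponential random variables\<close>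

text \<open>Outage and capacity are one average over mode configurations: that of
  \<open>\<phi>\<close> applied to the rate, with \<open>\<phi>\<close> the indicator of
  \<open>{r..}\<close> or the identity. The averaging is therefore carried out for general
  \<open>\<phi>\<close>, and outage is handled through the complementary event rate >= r, whose
  probability is an exponential tail. The laws \<open>given_mode\<close> always occur multiplied by
  the probability of the conditioning event. In this product they become unconditional expectations
  carrying an indicator, which stays correct when the event is null (\<open>p = 0\<close> or
  \<open>p = 1\<close>). Inclusion-exclusion is forced by the share of spectrum left to the CUEs: it
  depends on whether some pair is overlay, which is not a condition on each pair separately and so
  has no product probability. "No pair is overlay" is such a condition; it is the source of the
  powers of \<open>\<theta>\<close>. The capacity formula requires the CUE mean \<open>a\<close> to
  differ from the own mean \<open>g\<close>, because the two poles in the partial fractions coincide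
  when \<open>a = g\<close>.\<close>

lemma integrable_exp_kernel:
  fixes c \<kappa> :: real
  assumes "c > 0" "\<kappa> > 0"
  shows "integrable lborel (\<lambda>v. indicator {0..} v * (exp (- (c * v)) / (1 + \<kappa> * v)))"
\<comment> \<open>The denominator is at least 1 on \<open>{0..}\<close>, so the kernel is dominated
  by \<open>exp (- (c * v))\<close>, which is an exponential density divided by
  \<open>c\<close>.\<close>
proof (rule Bochner_Integration.integrable_bound)
  have "prob_space (density lborel (exponential_density c))"
    using prob_space_exponential_density assms by auto
  then have "(\<integral>\<^sup>+x. ennreal (exponential_density c x) \<partial>lborel) = 1"
    by (simp add: prob_space_def prob_space_axioms_def emeasure_density)
  then have "integrable lborel (exponential_density c)"
    using assms by (intro integrableI_nonneg) (auto simp: exponential_density_nonneg)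
  then show "integrable lborel (\<lambda>v. exponential_density c v / c)" by simp
  show "AE v in lborel. norm (indicator {0..} v * (exp (- (c * v)) / (1 + \<kappa> * v)))
          \<le> norm (exponential_density c v / c)"
    using assms
    by (intro AE_I2) (auto simp: exponential_density_def indicator_def mult.commute divide_simps
        intro!: mult_left_mono add_pos_nonneg)
qed measurable

text \<open>Substituting \<open>t = c + c * v\<close> in the exponential integral moves the lower
  limit from \<open>c\<close> to \<open>0\<close> and produces the factor \<open>exp (- c)\<close>,
  which the factor \<open>exp c\<close> in \<open>Psi\<close> cancels.\<close>

lemma Psi_eq_integral:
  assumes "c > 0"
  shows "Psi c = - (LBINT v:{0..}. exp (- (c * v)) / (1 + v))"
proof -
  let ?f = "\<lambda>t. indicator {c..} t * (exp (- t) / t) :: real"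
  have "(LBINT t:{c..}. exp (- t) / t) = c * (LBINT v. ?f (c + c * v))"
    using lborel_integral_real_affine[of c ?f c] assms by (simp add: set_lebesgue_integral_def)
  also have "(LBINT v. ?f (c + c * v)) =
      (LBINT v. (exp (- c) / c) * (indicator {0..} v * (exp (- (c * v)) / (1 + v))))"
  proof (rule Bochner_Integration.integral_cong)
    fix v :: real
    show "?f (c + c * v) = (exp (- c) / c) * (indicator {0..} v * (exp (- (c * v)) / (1 + v)))"
    proof (cases "v \<ge> 0")
      case True
      then have "1 + v > 0" "c + c * v = c * (1 + v)" by (auto simp: algebra_simps)
      then show ?thesis using assms True
        by (simp add: indicator_def exp_add[symmetric] mult_exp_exp)
    next
      case False
      then have "c * v < 0" using assms by (simp add: mult_pos_neg)
      then show ?thesis using False by (simp add: indicator_def)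
    qed
  qed simp
  also have "c * \<dots> = exp (- c) * (LBINT v:{0..}. exp (- (c * v)) / (1 + v))"
    using assms by (simp only: integral_mult_right_zero set_lebesgue_integral_def real_scaleR_def) simp
  finally show ?thesis
    unfolding Psi_def Ei_def by (simp add: mult.assoc[symmetric] mult_exp_exp)
qed

lemma Psi_scaled_eq_integral:
  assumes "c > 0" "\<kappa> > 0"
  shows "Psi (c / \<kappa>) = - (\<kappa> * (LBINT v:{0..}. exp (- (c * v)) / (1 + \<kappa> * v)))"
proof -
  let ?f = "\<lambda>w. indicator {0..} w * (exp (- ((c / \<kappa>) * w)) / (1 + w)) :: real"
  have "(LBINT w. ?f w) = \<kappa> * (LBINT v. ?f (0 + \<kappa> * v))"
    using lborel_integral_real_affine[of \<kappa> ?f 0] assms by simp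
  also have "\<dots> = (LBINT v. \<kappa> * (indicator {0..} v * (exp (- (c * v)) / (1 + \<kappa> * v))))"
    using assms
    by (subst integral_mult_right_zero[symmetric], intro Bochner_Integration.integral_cong)
       (auto simp: indicator_def zero_le_mult_iff)
  also have "\<dots> = \<kappa> * (LBINT v:{0..}. exp (- (c * v)) / (1 + \<kappa> * v))"
    by (simp only: integral_mult_right_zero set_lebesgue_integral_def real_scaleR_def)
  finally show ?thesis
    using assms by (simp add: Psi_eq_integral set_lebesgue_integral_def)
qed

text \<open>With \<open>\<kappa> = a / g\<close>, the partial fractions are 1 / ((1 + \<kappa> v) (1
  + v)) = (\<kappa> / (1 + \<kappa> v) - 1 / (1 + v)) / (\<kappa> - 1). Integrated against the
  exponential, the two summands give \<open>- Psi (c / \<kappa>)\<close> and \<open>- Psi c\<close>,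
  where \<open>c / \<kappa> = s / a\<close>.\<close>

lemma Psi_difference_has_integral:
  fixes s a g :: real
  assumes "s > 0" "a > 0" "g > 0" "a \<noteq> g"
  shows "has_bochner_integral lborel
           (\<lambda>v. indicator {0..} v * (exp (- (s / g * v)) / ((1 + a / g * v) * (1 + v))))
           ((Psi (s / g) - Psi (s / a)) / (a / g - 1))"
proof -
  define c \<kappa> where "c = s / g" and "\<kappa> = a / g"
  have pos: "c > 0" "\<kappa> > 0" and ne: "\<kappa> \<noteq> 1" and sa: "s / a = c / \<kappa>"
    using assms by (auto simp: c_def \<kappa>_def)
  let ?k = "\<lambda>\<kappa> v. indicator {0..} v * (exp (- (c * v)) / (1 + \<kappa> * v)) :: real"
  have "has_bochner_integral lborel (\<lambda>v. (\<kappa> * ?k \<kappa> v - ?k 1 v) / (\<kappa> - 1))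
      ((\<kappa> * integral\<^sup>L lborel (?k \<kappa>) - integral\<^sup>L lborel (?k 1)) / (\<kappa> - 1))"
    using integrable_exp_kernel[OF pos] integrable_exp_kernel[OF pos(1), of 1]
    by (intro has_bochner_integral_divide_zero has_bochner_integral_diff
        has_bochner_integral_mult_right has_bochner_integral_integrable) auto
  moreover have "(\<kappa> * ?k \<kappa> v - ?k 1 v) / (\<kappa> - 1)
      = indicator {0..} v * (exp (- (c * v)) / ((1 + \<kappa> * v) * (1 + v)))" for v
  proof (cases "v \<ge> 0")
    case True
    then have "1 + \<kappa> * v > 0" "1 + v > 0"
      using pos by (auto intro!: add_pos_nonneg)
    then show ?thesis
      using True ne by (simp add: divide_simps) (simp add: algebra_simps)
  qed simp
  moreover have "\<kappa> * integral\<^sup>L lborel (?k \<kappa>) - integral\<^sup>L lborel (?k 1) = Psi c - Psi (c / \<kappa>)"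
    using pos
    by (simp add: Psi_eq_integral[of c] Psi_scaled_eq_integral set_lebesgue_integral_def)
  ultimately show ?thesis
    unfolding sa by (simp add: c_def \<kappa>_def)
qed

text \<open>\<open>Psi\<close> is applied to the random interference, so its measurability is
  needed. The argument enters the integral only through the indicator of \<open>{x..}\<close>, which
  is jointly measurable in \<open>x\<close> and \<open>t\<close>.\<close>

lemma borel_measurable_Psi [measurable]: "Psi \<in> borel_measurable borel"
proof -
  have "(\<lambda>x::real. LBINT t::real. indicator {x..} t * (exp (- t) / t)) \<in> borel_measurable borel"
  proof (rule lborel.borel_measurable_lebesgue_integral)
    have "(\<lambda>(x, t). (if x \<le> t then exp (- t) / t else 0 :: real))
        \<in> borel_measurable (borel \<Otimes>\<^sub>M lborel :: (real \<times> real) measure)"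
      by measurable
    also have "(\<lambda>(x, t). (if x \<le> t then exp (- t) / t else 0)) = (\<lambda>(x, t). indicator {x..} t * (exp (- t) / t))"
      by (auto simp: fun_eq_iff)
    finally show "(\<lambda>(x, t). indicator {x..} t * (exp (- t) / t))
        \<in> borel_measurable (borel \<Otimes>\<^sub>M lborel :: (real \<times> real) measure)" .
  qed
  then show ?thesis
    unfolding Psi_def Ei_def set_lebesgue_integral_def by simp
qed

lemma convolve_nonneg:
  "(\<And>f y. f \<in> set fs \<Longrightarrow> 0 \<le> f y) \<Longrightarrow> 0 \<le> convolve fs x"
  by (induction fs x rule: convolve.induct) (auto intro!: Bochner_Integration.integral_nonneg)

section \<open>Expectations involving independent exponential variables\<close>

context prob_space
begin

text \<open>\<open>X\<close> has a density, so the boundary point \<open>a\<close> is null and the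
  tail agrees with the strict one.\<close>

lemma exponential_tail:
  assumes X: "distributed M lborel X (exponential_density l)" and "l > 0" "0 \<le> a"
  shows "prob {\<omega> \<in> space M. a \<le> X \<omega>} = exp (- a * l)"
proof -
  have [measurable]: "X \<in> borel_measurable M"
    using distributed_measurable[OF X] by simp
  have "AE \<omega> in M. X \<omega> \<noteq> a"
  proof (subst distributed_AE2[OF X])
    have "AE x in lborel. x \<noteq> a" by (rule AE_lborel_singleton)
    then show "AE x in lborel. 0 < ennreal (exponential_density l x) \<longrightarrow> x \<noteq> a" by auto
  qed simp
  then have "prob {\<omega> \<in> space M. a \<le> X \<omega>} = prob {\<omega> \<in> space M. a < X \<omega>}"
    by (intro finite_measure_eq_AE) auto
  also have "\<dots> = exp (- a * l)"
    by (rule exponential_distributedD_gt) fact+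
  finally show ?thesis .
qed

text \<open>Multiplying the density of rate \<open>l\<close> by \<open>exp (- s * x)\<close> gives
  \<open>l / (l + s)\<close> times the density of rate \<open>l + s\<close>, which has total mass
  1.\<close>

lemma exponential_laplace:
  assumes X: "distributed M lborel X (exponential_density l)" and l: "l > 0" and s: "0 \<le> s"
  shows "expectation (\<lambda>\<omega>. exp (- s * X \<omega>)) = l / (l + s)"
proof -
  have "expectation (\<lambda>\<omega>. exp (- s * X \<omega>)) = (LBINT x. exponential_density l x * exp (- s * x))"
    using l by (subst distributed_integral[OF X, symmetric]) (auto simp: exponential_density_nonneg)
  also have "\<dots> = (LBINT x. l / (l + s) * exponential_density (l + s) x)"
    using l s by (intro Bochner_Integration.integral_cong)
      (auto simp: exponential_density_def mult_exp_exp distrib_left)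
  also have "\<dots> = l / (l + s) * (LBINT x. exponential_density (l + s) x)"
    by simp
  also have "(LBINT x. exponential_density (l + s) x) = 1"
  proof -
    interpret E: prob_space "density lborel (exponential_density (l + s))"
      using l s by (intro prob_space_exponential_density) auto
    have "(\<integral>\<^sup>+x. ennreal (exponential_density (l + s) x) \<partial>lborel) = 1"
      using E.emeasure_space_1 by (simp add: emeasure_density)
    then show ?thesis
      using l s by (subst integral_eq_nn_integral) (auto simp: exponential_density_nonneg)
  qed
  finally show ?thesis by simp
qed

lemma exponential_AE_nonneg:
  assumes X: "distributed M lborel X (exponential_density l)"
  shows "AE \<omega> in M. 0 \<le> X \<omega>"
  by (subst distributed_AE2[OF X]) (auto simp: exponential_density_def)

text \<open>By independence the joint law is a product. Slicing the half-plane at a fixed value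
  \<open>w\<close> of \<open>W\<close> leaves the tail of \<open>X\<close> at \<open>t * w\<close>,
  and the signs of \<open>t\<close> and \<open>W\<close> keep this point in the range of the tail
  formula.\<close>

lemma prob_exponential_ge_scaled:
  assumes X: "distributed M lborel X (exponential_density l)" and l: "l > 0"
    and ind: "indep_var borel X borel W" and W: "AE \<omega> in M. 0 \<le> W \<omega>" and t: "0 \<le> t"
  shows "prob {\<omega> \<in> space M. t * W \<omega> \<le> X \<omega>} = expectation (\<lambda>\<omega>. exp (- (t * l) * W \<omega>))"
proof -
  have [measurable]: "X \<in> borel_measurable M" "W \<in> borel_measurable M"
    using ind by (auto dest: indep_var_rv1 indep_var_rv2)
  interpret DW: prob_space "distr M borel W" by (rule prob_space_distr) simp
  interpret DX: prob_space "distr M borel X" by (rule prob_space_distr) simp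
  interpret P: pair_sigma_finite "distr M borel X" "distr M borel W" ..
  have eq: "distr M borel X \<Otimes>\<^sub>M distr M borel W = distr M (borel \<Otimes>\<^sub>M borel) (\<lambda>\<omega>. (X \<omega>, W \<omega>))"
    using ind by (simp add: indep_var_distribution_eq)
  let ?A = "{(x, w). t * w \<le> x} :: (real \<times> real) set"
  have A [measurable]: "?A \<in> sets (borel \<Otimes>\<^sub>M borel)"
  proof -
    have "{z \<in> space (borel \<Otimes>\<^sub>M borel). t * snd z \<le> fst z} \<in> sets (borel \<Otimes>\<^sub>M borel)"
      by measurable
    then show ?thesis by (simp add: space_pair_measure case_prod_unfold)
  qed
  have "emeasure M {\<omega> \<in> space M. t * W \<omega> \<le> X \<omega>}
      = emeasure (distr M (borel \<Otimes>\<^sub>M borel) (\<lambda>\<omega>. (X \<omega>, W \<omega>))) ?A"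
    by (subst emeasure_distr) (auto intro!: arg_cong2[where f = emeasure])
  also have "\<dots> = (\<integral>\<^sup>+w. emeasure (distr M borel X) ((\<lambda>x. (x, w)) -` ?A) \<partial>distr M borel W)"
    unfolding eq[symmetric] by (rule P.emeasure_pair_measure_alt2) measurable
  also have "\<dots> = (\<integral>\<^sup>+\<omega>. emeasure (distr M borel X) ((\<lambda>x. (x, W \<omega>)) -` ?A) \<partial>M)"
    using P.measurable_emeasure_Pair2[of ?A] by (intro nn_integral_distr) simp_all
  also have "\<dots> = (\<integral>\<^sup>+\<omega>. ennreal (exp (- (t * l) * W \<omega>)) \<partial>M)"
  proof (rule nn_integral_cong_AE)
    show "AE \<omega> in M. emeasure (distr M borel X) ((\<lambda>x. (x, W \<omega>)) -` ?A)
            = ennreal (exp (- (t * l) * W \<omega>))"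
      using W
    proof eventually_elim
      case (elim \<omega>)
      have "emeasure (distr M borel X) ((\<lambda>x. (x, W \<omega>)) -` ?A)
          = prob {\<omega>' \<in> space M. t * W \<omega> \<le> X \<omega>'}"
        by (subst emeasure_distr) (auto simp: emeasure_eq_measure intro!: arg_cong[where f = prob])
      also have "\<dots> = ennreal (exp (- (t * W \<omega>) * l))"
        using elim t by (subst exponential_tail[OF X l]) auto
      finally show ?case by (simp add: mult_ac)
    qed
  qed
  finally show ?thesis
    by (subst integral_eq_nn_integral) (auto simp: measure_def)
qed

text \<open>Layer-cake formula, from \<open>ln (1 + y) = (LBINT v:{0..y}. 1 / (1 + v))\<close>.\<close>

lemma nn_integral_ln_quotient:
  assumes [measurable]: "X \<in> borel_measurable M" "W \<in> borel_measurable M"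
    and X: "AE \<omega> in M. 0 \<le> X \<omega>" and W: "AE \<omega> in M. 0 < W \<omega>"
  shows "(\<integral>\<^sup>+\<omega>. ennreal (ln (1 + X \<omega> / W \<omega>)) \<partial>M)
    = (\<integral>\<^sup>+v. ennreal (indicator {0..} v / (1 + v) * prob {\<omega> \<in> space M. v * W \<omega> \<le> X \<omega>}) \<partial>lborel)"
proof -
  interpret P: pair_sigma_finite M lborel ..
  let ?f = "\<lambda>\<omega> v. ennreal (indicator {0..} v / (1 + v)) * indicator {\<omega> \<in> space M. v * W \<omega> \<le> X \<omega>} \<omega>"
  have m [measurable]: "(\<lambda>(\<omega>, v). ?f \<omega> v) \<in> borel_measurable (M \<Otimes>\<^sub>M lborel)"
    by measurable
  have "(\<integral>\<^sup>+\<omega>. ennreal (ln (1 + X \<omega> / W \<omega>)) \<partial>M) = (\<integral>\<^sup>+\<omega>. \<integral>\<^sup>+v. ?f \<omega> v \<partial>lborel \<partial>M)"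
  proof (rule nn_integral_cong_AE)
    show "AE \<omega> in M. ennreal (ln (1 + X \<omega> / W \<omega>)) = (\<integral>\<^sup>+v. ?f \<omega> v \<partial>lborel)"
      using X W AE_space
    proof eventually_elim
      case (elim \<omega>)
      define y where "y = X \<omega> / W \<omega>"
      have y: "y \<ge> 0" using elim by (simp add: y_def)
      have "(\<integral>\<^sup>+v. ?f \<omega> v \<partial>lborel) = (\<integral>\<^sup>+v. ennreal (1 / (1 + v)) * indicator {0..y} v \<partial>lborel)"
        using elim by (intro nn_integral_cong) (auto simp: y_def indicator_def field_simps)
      also have "\<dots> = ennreal (ln (1 + y) - ln (1 + 0))"
        using y by (intro nn_integral_FTC_Icc)
          (auto intro!: derivative_eq_intros simp: divide_inverse)
      finally show ?case by (simp add: y_def)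
    qed
  qed
  also have "\<dots> = (\<integral>\<^sup>+v. \<integral>\<^sup>+\<omega>. ?f \<omega> v \<partial>M \<partial>lborel)"
    by (rule P.Fubini'[symmetric]) measurable
  also have "\<dots> = (\<integral>\<^sup>+v. ennreal (indicator {0..} v / (1 + v) * prob {\<omega> \<in> space M. v * W \<omega> \<le> X \<omega>}) \<partial>lborel)"
  proof (rule nn_integral_cong)
    fix v :: real
    have "(\<integral>\<^sup>+\<omega>. ?f \<omega> v \<partial>M)
        = ennreal (indicator {0..} v / (1 + v)) * emeasure M {\<omega> \<in> space M. v * W \<omega> \<le> X \<omega>}"
      by (rule nn_integral_cmult_indicator) measurable
    also have "\<dots> = ennreal (indicator {0..} v / (1 + v) * prob {\<omega> \<in> space M. v * W \<omega> \<le> X \<omega>})"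
      unfolding emeasure_eq_measure by (rule ennreal_mult[symmetric]) (auto simp: indicator_def)
    finally show "(\<integral>\<^sup>+\<omega>. ?f \<omega> v \<partial>M) = \<dots>" .
  qed
  finally show ?thesis .
qed

text \<open>The two independence hypotheses act at different places: \<open>X\<close> against
  \<open>Y + S\<close> permits conditioning on the denominator, and \<open>Y\<close> against
  \<open>S\<close> splits the resulting exponential into two expectations. The first of these is the
  Laplace transform of \<open>Y\<close> at \<open>t / g\<close>. The law of \<open>S\<close> is left
  open, so that an empty set of interferers is covered too.\<close>

lemma prob_sinr_ge:
  fixes a g t :: real
  assumes X: "distributed M lborel X (exponential_density (1 / g))"
    and Y: "distributed M lborel Y (exponential_density (1 / a))"
    and pos: "a > 0" "g > 0" and t: "t \<ge> 0" and S: "AE \<omega> in M. 0 \<le> S \<omega>"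
    and indX: "indep_var borel X borel (\<lambda>\<omega>. Y \<omega> + S \<omega>)" and indY: "indep_var borel Y borel S"
  shows "prob {\<omega> \<in> space M. t * (Y \<omega> + S \<omega> + 1) \<le> X \<omega>}
    = expectation (\<lambda>\<omega>. exp (- (t * (S \<omega> + 1)) / g)) / (a / g * t + 1)"
proof -
  have [measurable]: "Y \<in> borel_measurable M" "S \<in> borel_measurable M"
    using indY by (auto dest: indep_var_rv1 indep_var_rv2)
  have Y0: "AE \<omega> in M. 0 \<le> Y \<omega>" by (rule exponential_AE_nonneg[OF Y])
  have "indep_var borel (id \<circ> X) borel ((\<lambda>w. w + 1) \<circ> (\<lambda>\<omega>. Y \<omega> + S \<omega>))"
    by (rule indep_var_compose[OF indX]) auto
  then have "indep_var borel X borel (\<lambda>\<omega>. Y \<omega> + S \<omega> + 1)" by (simp add: comp_def)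
  then have "prob {\<omega> \<in> space M. t * (Y \<omega> + S \<omega> + 1) \<le> X \<omega>}
      = expectation (\<lambda>\<omega>. exp (- (t * (1 / g)) * (Y \<omega> + S \<omega> + 1)))"
    using pos t S Y0 by (intro prob_exponential_ge_scaled[OF X]) auto
  also have "\<dots> = expectation (\<lambda>\<omega>. exp (- (t / g) * Y \<omega>) * exp (- (t * (S \<omega> + 1)) / g))"
    by (intro Bochner_Integration.integral_cong) (auto simp: mult_exp_exp add_divide_distrib diff_divide_distrib distrib_left)
  also have "\<dots> = expectation (\<lambda>\<omega>. exp (- (t / g) * Y \<omega>)) * expectation (\<lambda>\<omega>. exp (- (t * (S \<omega> + 1)) / g))"
  proof (rule indep_var_lebesgue_integral)
    show "integrable M (\<lambda>\<omega>. exp (- (t / g) * Y \<omega>))"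
      by (rule integrable_const_bound[where B = 1]) (use Y0 pos t in auto)
    show "integrable M (\<lambda>\<omega>. exp (- (t * (S \<omega> + 1)) / g))"
      by (rule integrable_const_bound[where B = 1]) (use S pos t in \<open>auto simp: zero_le_divide_iff\<close>)
    have "indep_var borel ((\<lambda>y. exp (- (t / g) * y)) \<circ> Y) borel ((\<lambda>s. exp (- (t * (s + 1)) / g)) \<circ> S)"
      by (rule indep_var_compose[OF indY]) auto
    then show "indep_var borel (\<lambda>\<omega>. exp (- (t / g) * Y \<omega>)) borel (\<lambda>\<omega>. exp (- (t * (S \<omega> + 1)) / g))"
      by (simp add: comp_def)
  qed
  also have "expectation (\<lambda>\<omega>. exp (- (t / g) * Y \<omega>)) = 1 / (a / g * t + 1)"
    using exponential_laplace[OF Y, of "t / g"] pos t by (simp add: field_simps)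
  finally show ?thesis by simp
qed

text \<open>Fubini is applied twice: within \<open>nn_integral_ln_quotient\<close>, to reach an
  integral over \<open>v\<close> of probabilities, and afterwards to bring the
  \<open>v\<close>-integral back inside, where it is evaluated at the fixed value
  \<open>s = S + 1\<close>. Nonnegative integrals are used because integrability of the logarithm is
  itself part of the claim; it follows from finiteness of the final value.\<close>

lemma expectation_ln_sinr:
  fixes a g :: real
  assumes X: "distributed M lborel X (exponential_density (1 / g))"
    and Y: "distributed M lborel Y (exponential_density (1 / a))"
    and pos: "a > 0" "g > 0" and ne: "a \<noteq> g" and S: "AE \<omega> in M. 0 \<le> S \<omega>"
    and indX: "indep_var borel X borel (\<lambda>\<omega>. Y \<omega> + S \<omega>)" and indY: "indep_var borel Y borel S"
  shows "has_bochner_integral M (\<lambda>\<omega>. ln (1 + X \<omega> / (Y \<omega> + S \<omega> + 1)))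
    (expectation (\<lambda>\<omega>. (Psi ((S \<omega> + 1) / g) - Psi ((S \<omega> + 1) / a)) / (a / g - 1)))"
proof -
  have [measurable]: "X \<in> borel_measurable M" "Y \<in> borel_measurable M" "S \<in> borel_measurable M"
    using indX indY by (auto dest: indep_var_rv1 indep_var_rv2)
  have Y0: "AE \<omega> in M. 0 \<le> Y \<omega>" by (rule exponential_AE_nonneg[OF Y])
  have X0: "AE \<omega> in M. 0 \<le> X \<omega>" by (rule exponential_AE_nonneg[OF X])
  interpret P: pair_sigma_finite M lborel ..
  \<comment> \<open>For \<open>S + 1 = s\<close> fixed, this is the layer-cake weight
    \<open>1 / (1 + v)\<close> times the Laplace factor of \<open>Y\<close> times the remaining
    exponential.\<close>
  let ?k = "\<lambda>s v. indicator {0..} v * (exp (- (s / g * v)) / ((1 + a / g * v) * (1 + v))) :: real"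
  let ?F = "\<lambda>s. (Psi (s / g) - Psi (s / a)) / (a / g - 1)"
  have k0: "?k s v \<ge> 0" for s v
    using pos by (auto simp: indicator_def)
  have kF: "(\<integral>\<^sup>+v. ennreal (?k s v) \<partial>lborel) = ennreal (?F s)" and F0: "?F s \<ge> 0" if "s > 0" for s
  proof -
    have h: "has_bochner_integral lborel (?k s) (?F s)"
      by (rule Psi_difference_has_integral) (use that pos ne in auto)
    then show "(\<integral>\<^sup>+v. ennreal (?k s v) \<partial>lborel) = ennreal (?F s)"
      using k0 by (subst nn_integral_eq_integral) (auto simp: has_bochner_integral_iff)
    show "?F s \<ge> 0"
      using h k0 Bochner_Integration.integral_nonneg[of lborel "?k s"] by (simp add: has_bochner_integral_iff)
  qed
  have "(\<integral>\<^sup>+\<omega>. ennreal (ln (1 + X \<omega> / (Y \<omega> + S \<omega> + 1))) \<partial>M)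
      = (\<integral>\<^sup>+v. ennreal (indicator {0..} v / (1 + v) *
            prob {\<omega> \<in> space M. v * (Y \<omega> + S \<omega> + 1) \<le> X \<omega>}) \<partial>lborel)"
    using X0 Y0 S by (intro nn_integral_ln_quotient) auto
  also have "\<dots> = (\<integral>\<^sup>+v. \<integral>\<^sup>+\<omega>. ennreal (?k (S \<omega> + 1) v) \<partial>M \<partial>lborel)"
  proof (rule nn_integral_cong)
    fix v :: real
    show "ennreal (indicator {0..} v / (1 + v) * prob {\<omega> \<in> space M. v * (Y \<omega> + S \<omega> + 1) \<le> X \<omega>})
        = (\<integral>\<^sup>+\<omega>. ennreal (?k (S \<omega> + 1) v) \<partial>M)"
    proof (cases "v \<ge> 0")
      case True
      have "indicator {0..} v / (1 + v) * prob {\<omega> \<in> space M. v * (Y \<omega> + S \<omega> + 1) \<le> X \<omega>}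
          = expectation (\<lambda>\<omega>. exp (- (v * (S \<omega> + 1)) / g)) / (1 + v) / (a / g * v + 1)"
        using True by (simp add: prob_sinr_ge[OF X Y pos True S indX indY])
      also have "\<dots> = expectation (\<lambda>\<omega>. exp (- (v * (S \<omega> + 1)) / g) / (1 + v) / (a / g * v + 1))"
        by simp
      also have "\<dots> = expectation (\<lambda>\<omega>. ?k (S \<omega> + 1) v)"
      proof (rule Bochner_Integration.integral_cong)
        fix \<omega>
        have "- (v * (S \<omega> + 1)) / g = - ((S \<omega> + 1) / g * v)" by simp
        then show "exp (- (v * (S \<omega> + 1)) / g) / (1 + v) / (a / g * v + 1) = ?k (S \<omega> + 1) v"
          using True by (simp only: divide_divide_eq_left) (simp add: mult.commute add.commute)
      qed simp
      finally have eq: "indicator {0..} v / (1 + v) * prob {\<omega> \<in> space M. v * (Y \<omega> + S \<omega> + 1) \<le> X \<omega>}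
          = expectation (\<lambda>\<omega>. ?k (S \<omega> + 1) v)" .
      have "integrable M (\<lambda>\<omega>. ?k (S \<omega> + 1) v)"
      proof (rule integrable_const_bound[where B = 1])
        show "AE \<omega> in M. norm (?k (S \<omega> + 1) v) \<le> 1"
          using S
        proof eventually_elim
          case (elim \<omega>)
          have "1 * 1 \<le> (1 + a / g * v) * (1 + v)"
            using True pos by (intro mult_mono) auto
          moreover have "exp (- ((S \<omega> + 1) / g * v)) \<le> 1"
            using elim True pos by simp
          ultimately have "exp (- ((S \<omega> + 1) / g * v)) / ((1 + a / g * v) * (1 + v)) \<le> 1 / 1"
            by (intro frac_le) simp_all
          then show ?case
            using True by (simp only: real_norm_def abs_of_nonneg[OF k0]) simp
        qed
      qed measurable
      then show ?thesis
        unfolding eq using k0 by (intro nn_integral_eq_integral[symmetric]) auto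
    qed simp
  qed
  also have "\<dots> = (\<integral>\<^sup>+\<omega>. \<integral>\<^sup>+v. ennreal (?k (S \<omega> + 1) v) \<partial>lborel \<partial>M)"
    by (rule P.Fubini') measurable
  also have "\<dots> = (\<integral>\<^sup>+\<omega>. ennreal (?F (S \<omega> + 1)) \<partial>M)"
    by (intro nn_integral_cong_AE eventually_mono[OF S] kF) simp
  finally have nn: "(\<integral>\<^sup>+\<omega>. ennreal (ln (1 + X \<omega> / (Y \<omega> + S \<omega> + 1))) \<partial>M)
      = (\<integral>\<^sup>+\<omega>. ennreal (?F (S \<omega> + 1)) \<partial>M)" .
  \<comment> \<open>The kernel decreases in \<open>s\<close>, hence so does \<open>?F\<close>. Since
    \<open>S \<ge> 0\<close>, its value at \<open>s = 1\<close> is a bound almost everywhere, which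
    makes \<open>?F (S + 1)\<close> integrable.\<close>
  have Fm: "AE \<omega> in M. ?F (S \<omega> + 1) \<le> ?F 1"
    using S
  proof eventually_elim
    case (elim \<omega>)
    have "ennreal (?F (S \<omega> + 1)) \<le> ennreal (?F 1)"
    proof -
      have "(\<integral>\<^sup>+v. ennreal (?k (S \<omega> + 1) v) \<partial>lborel) \<le> (\<integral>\<^sup>+v. ennreal (?k 1 v) \<partial>lborel)"
        using elim pos
        by (intro nn_integral_mono ennreal_leI)
           (auto simp: indicator_def distrib_right intro!: divide_right_mono)
      moreover have "0 < S \<omega> + 1" using elim by simp
      ultimately show ?thesis by (simp only: kF zero_less_one)
    qed
    then show ?case using F0[of 1] by simp
  qed
  have iF: "integrable M (\<lambda>\<omega>. ?F (S \<omega> + 1))"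
  proof (rule integrable_const_bound[where B = "?F 1"])
    show "AE \<omega> in M. norm (?F (S \<omega> + 1)) \<le> ?F 1"
      using Fm S
    proof eventually_elim
      case (elim \<omega>)
      then have "0 \<le> ?F (S \<omega> + 1)" by (intro F0) simp
      then show ?case using elim by (simp only: real_norm_def abs_of_nonneg)
    qed
  qed measurable
  show ?thesis
  proof (rule has_bochner_integral_nn_integral)
    show "AE \<omega> in M. 0 \<le> ln (1 + X \<omega> / (Y \<omega> + S \<omega> + 1))"
      using X0 Y0 S by eventually_elim auto
    show "0 \<le> expectation (\<lambda>\<omega>. ?F (S \<omega> + 1))"
      by (intro integral_nonneg_AE eventually_mono[OF S] F0) simp
    show "(\<integral>\<^sup>+\<omega>. ennreal (ln (1 + X \<omega> / (Y \<omega> + S \<omega> + 1))) \<partial>M) = ennreal (expectation (\<lambda>\<omega>. ?F (S \<omega> + 1)))"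
      unfolding nn
      by (intro nn_integral_eq_integral iF eventually_mono[OF S] F0) simp
  qed measurable
qed

text \<open>This is the layer-cake formula with \<open>W = 1\<close>: the tail
  \<open>exp (- v / g)\<close> yields the integral form of \<open>Psi\<close> directly, without
  partial fractions and so without a condition on the means.\<close>

lemma expectation_ln_snr:
  assumes X: "distributed M lborel X (exponential_density (1 / g))" and g: "g > 0"
  shows "has_bochner_integral M (\<lambda>\<omega>. ln (1 + X \<omega>)) (- Psi (1 / g))"
proof -
  have [measurable]: "X \<in> borel_measurable M"
    using distributed_measurable[OF X] by simp
  have X0: "AE \<omega> in M. 0 \<le> X \<omega>" by (rule exponential_AE_nonneg[OF X])
  let ?k = "\<lambda>v. indicator {0..} v * (exp (- (1 / g * v)) / (1 + 1 * v)) :: real"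
  have k: "integrable lborel ?k"
    using g by (intro integrable_exp_kernel) auto
  have P: "- Psi (1 / g) = integral\<^sup>L lborel ?k"
    using g by (simp add: Psi_eq_integral set_lebesgue_integral_def)
  have "(\<integral>\<^sup>+\<omega>. ennreal (ln (1 + X \<omega> / 1)) \<partial>M)
      = (\<integral>\<^sup>+v. ennreal (indicator {0..} v / (1 + v) * prob {\<omega> \<in> space M. v * 1 \<le> X \<omega>}) \<partial>lborel)"
    using X0 by (intro nn_integral_ln_quotient) auto
  also have "\<dots> = (\<integral>\<^sup>+v. ennreal (?k v) \<partial>lborel)"
    using g by (intro nn_integral_cong) (auto simp: indicator_def exponential_tail[OF X])
  also have "\<dots> = ennreal (integral\<^sup>L lborel ?k)"
    using k by (intro nn_integral_eq_integral) (auto simp: indicator_def)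
  finally have nn: "(\<integral>\<^sup>+\<omega>. ennreal (ln (1 + X \<omega>)) \<partial>M) = ennreal (- Psi (1 / g))"
    unfolding P by simp
  show ?thesis
  proof (rule has_bochner_integral_nn_integral)
    show "AE \<omega> in M. 0 \<le> ln (1 + X \<omega>)"
      using X0 by eventually_elim auto
    show "0 \<le> - Psi (1 / g)"
      unfolding P by (intro Bochner_Integration.integral_nonneg) (auto simp: indicator_def)
  qed (use nn in auto)
qed

end

section \<open>Mode selection\<close>

lemma prod_if_mem:
  assumes "finite A" "B \<subseteq> A"
  shows "(\<Prod>k\<in>A. if k \<in> B then x else (y :: 'b :: comm_monoid_mult)) = x ^ card B * y ^ (card A - card B)"
proof -
  have "A \<inter> {k. k \<in> B} = B" "A \<inter> - {k. k \<in> B} = A - B" using assms by auto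
  then show ?thesis
    using assms by (simp add: prod.If_cases card_Diff_subset finite_subset)
qed

text \<open>Source of the binomial coefficients: the overlay rate depends on the set of overlay
  pairs only through its size.\<close>

lemma sum_Pow_card:
  fixes f :: "nat \<Rightarrow> real"
  assumes "finite A"
  shows "(\<Sum>B\<in>Pow A. f (card B)) = (\<Sum>k\<le>card A. real (card A choose k) * f k)"
proof -
  have "(\<Sum>B\<in>Pow A. f (card B)) = (\<Sum>k\<le>card A. \<Sum>B\<in>{B \<in> Pow A. card B = k}. f (card B))"
    using assms by (intro sum.group[symmetric]) (auto intro: card_mono)
  also have "\<dots> = (\<Sum>k\<le>card A. real (card A choose k) * f k)"
    using n_subsets[OF assms] by (intro sum.cong) (auto simp: Pow_def conj_commute)
  finally show ?thesis .
qed

lemma pmf_mode_pmf: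
  assumes "0 \<le> p" "p \<le> 1"
  shows "pmf (mode_pmf n p) Overlay = 1 - p"
    and "i \<in> {1..n} \<Longrightarrow> pmf (mode_pmf n p) (Underlay i) = p / real n"
proof -
  have "pmf (map_pmf Underlay (pmf_of_set {1..n})) Overlay = 0"
    by (auto simp: pmf_eq_0_set_pmf)
  then show "pmf (mode_pmf n p) Overlay = 1 - p"
    using assms by (simp add: mode_pmf_def pmf_bind)
  assume i: "i \<in> {1..n}"
  have "pmf (map_pmf Underlay (pmf_of_set {1..n})) (Underlay i) = pmf (pmf_of_set {1..n}) i"
    by (rule pmf_map_inj') (simp add: inj_def)
  also have "\<dots> = 1 / real n"
    using i by (subst pmf_of_set) auto
  finally show "pmf (mode_pmf n p) (Underlay i) = p / real n"
    using assms by (simp add: mode_pmf_def pmf_bind)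
qed

text \<open>These are the bases of all powers in the closed forms. The last value is
  \<open>\<theta>\<close>: a pair that is neither overlay nor on the spectrum of CUE
  \<open>i\<close> is underlay with one of the other CUEs, and 1 - p / n - (1 - p) = p (1 - 1 /
  n).\<close>

lemma prob_mode_pmf:
  assumes p: "0 \<le> p" "p \<le> 1" and i: "i \<in> {1..n}"
  defines "P \<equiv> measure_pmf.prob (mode_pmf n p)"
  shows "P {Overlay} = 1 - p" "P (- {Overlay}) = p"
    and "P {Underlay i} = p / real n" "P (- {Underlay i}) = 1 - p / real n"
    and "P (- {Underlay i, Overlay}) = p * (1 - 1 / real n)"
proof -
  have compl: "P (- A) = 1 - P A" for A
    using measure_pmf.prob_compl[of A "mode_pmf n p"] by (simp add: P_def Compl_eq_Diff_UNIV)
  have single: "P {c} = pmf (mode_pmf n p) c" for c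
    by (simp add: P_def measure_pmf_single)
  have two: "P {Underlay i, Overlay} = p / real n + (1 - p)"
    using pmf_mode_pmf[OF p] i by (simp add: P_def measure_measure_pmf_finite)
  show "P {Overlay} = 1 - p" "P (- {Overlay}) = p"
    "P {Underlay i} = p / real n" "P (- {Underlay i}) = 1 - p / real n"
    "P (- {Underlay i, Overlay}) = p * (1 - 1 / real n)"
    using pmf_mode_pmf[OF p] i by (simp_all add: compl single two algebra_simps)
qed

section \<open>Conditional laws multiplied by the probability of the condition\<close>

context prob_space
begin

text \<open>The multiplied form avoids division by \<open>prob A\<close>: for a null
  \<open>A\<close> both sides vanish.\<close>

lemma measure_uniform_measure_times:
  assumes "A \<in> events" "B \<in> events"
  shows "prob A * measure (uniform_measure M A) B = prob (A \<inter> B)"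
proof (cases "prob A = 0")
  case True
  then show ?thesis
    using assms finite_measure_mono[of "A \<inter> B" A] measure_nonneg[of M "A \<inter> B"] by auto
next
  case False
  then show ?thesis using assms by (simp add: emeasure_eq_measure)
qed

lemma integral_uniform_measure_times:
  fixes f :: "'a \<Rightarrow> real"
  assumes A: "A \<in> events" and f [measurable]: "f \<in> borel_measurable M"
  shows "prob A * integral\<^sup>L (uniform_measure M A) f = expectation (\<lambda>\<omega>. indicator A \<omega> * f \<omega>)"
proof (cases "prob A = 0")
  case True
  then have "AE \<omega> in M. \<omega> \<notin> A"
    using A by (simp add: prob_eq_0)
  then have "expectation (\<lambda>\<omega>. indicator A \<omega> * f \<omega>) = expectation (\<lambda>\<omega>. 0)"
    using A by (intro integral_cong_AE) (auto elim!: eventually_mono)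
  then show ?thesis using True by simp
next
  case False
  then have pos: "prob A > 0" by (simp add: zero_less_measure_iff)
  have "uniform_measure M A = density M (\<lambda>x. ennreal (indicator A x / prob A))"
    unfolding uniform_measure_def
    using pos by (intro arg_cong[where f = "density M"] ext)
      (auto simp: emeasure_eq_measure divide_ennreal split: split_indicator simp flip: ennreal_1)
  then have "integral\<^sup>L (uniform_measure M A) f = expectation (\<lambda>\<omega>. indicator A \<omega> / prob A * f \<omega>)"
    using A by (simp add: integral_density)
  also have "\<dots> = expectation (\<lambda>\<omega>. indicator A \<omega> * f \<omega>) / prob A"
    by (subst integral_divide_zero[symmetric]) (simp add: field_simps)
  finally show ?thesis using pos by simp
qed

end

text \<open>
  An injection of the modes into the reals, so that SNRs and modes form one family of random
  variables with a common value type.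
\<close>

definition mode_code :: "d2d_mode \<Rightarrow> real" where
  "mode_code c = (case c of Overlay \<Rightarrow> 0 | Underlay i \<Rightarrow> real (Suc i))"

lemma mode_code_eq_iff [simp]: "mode_code c = mode_code d \<longleftrightarrow> c = d"
  by (auto simp: mode_code_def split: d2d_mode.splits)

lemma mode_code_image_borel: "mode_code ` C \<in> sets borel"
proof (rule sets.countable)
  have "mode_code ` C \<subseteq> \<nat>"
    by (auto simp: mode_code_def split: d2d_mode.splits)
  moreover have "countable (\<nat> :: real set)" by (simp add: Nats_def)
  ultimately show "countable (mode_code ` C)" by (rule countable_subset)
qed auto

section \<open>Independence of mode selections and SNRs\<close>

context d2d_network
begin

abbreviation links :: "(transmitter \<times> receiver) set" where
  "links \<equiv> transmitters n m \<times> receivers m"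

definition real_family :: "(transmitter \<times> receiver) + nat \<Rightarrow> 'a \<Rightarrow> real" where
  "real_family = case_sum (\<lambda>(a, b). SNR a b) (\<lambda>k \<omega>. mode_code (mode k \<omega>))"

lemma real_family_simps [simp]:
  "real_family (Inl (a, b)) = SNR a b" "real_family (Inr k) = (\<lambda>\<omega>. mode_code (mode k \<omega>))"
  by (simp_all add: real_family_def)

lemma SNR_measurable: "a \<in> transmitters n m \<Longrightarrow> b \<in> receivers m \<Longrightarrow> SNR a b \<in> borel_measurable M"
  using distributed_measurable[OF SNR_exponential] by simp

lemma indep_vars_real_family: "indep_vars (\<lambda>_. borel) real_family (links <+> {1..m})"
  unfolding indep_vars_def2
proof (intro conjI ballI)
  fix x assume x: "x \<in> links <+> {1..m}"
  show "random_variable borel (real_family x)"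
  proof (cases x)
    case (Inr k)
    then have "mode k \<in> measurable M (count_space UNIV)"
      using x mode_measurable by auto
    then show ?thesis
      unfolding Inr real_family_simps by (rule measurable_compose) simp
  qed (use x SNR_measurable in \<open>auto simp: real_family_def\<close>)
next
  show "indep_sets (\<lambda>x. {real_family x -` A \<inter> space M | A. A \<in> sets borel}) (links <+> {1..m})"
  proof (rule indep_sets_mono[OF indep subset_refl])
    fix x
    show "{real_family x -` A \<inter> space M | A. A \<in> sets borel} \<subseteq>
       case_sum (\<lambda>(a, b). {SNR a b -` A \<inter> space M | A. A \<in> sets borel})
            (\<lambda>k. {mode k -` A \<inter> space M | A. A \<in> UNIV}) x"
    proof (cases x)
      case (Inr k)
      have "\<exists>C. real_family x -` A \<inter> space M = mode k -` C \<inter> space M" for A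
        by (rule exI[of _ "mode_code -` A"]) (auto simp: Inr)
      then show ?thesis unfolding Inr by auto
    qed (auto simp: real_family_def)
  qed
qed

text \<open>One separate constraint per pair, so that the probability is a product. The event is not
  intersected with \<open>space M\<close>, so that its indicator is a function of the coded modes at
  every point.\<close>

definition mode_event :: "(nat \<Rightarrow> d2d_mode set) \<Rightarrow> 'a set" where
  "mode_event C = {\<omega>. \<forall>k\<in>{1..m}. mode k \<omega> \<in> C k}"

lemma prob_mode:
  assumes "k \<in> {1..m}"
  shows "prob (mode k -` C \<inter> space M) = measure_pmf.prob (mode_pmf n p) C"
  using measure_distr[OF mode_measurable[OF assms], of C] mode_distribution[OF assms] by simp

lemma prob_mode_event:
  assumes "m \<ge> 1"
  shows "prob (mode_event C \<inter> space M) = (\<Prod>k=1..m. measure_pmf.prob (mode_pmf n p) (C k))"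
proof -
  let ?A = "\<lambda>x. case x of Inl l \<Rightarrow> {} | Inr k \<Rightarrow> mode_code ` C k"
  have "prob (\<Inter>x\<in>Inr ` {1..m}. real_family x -` ?A x \<inter> space M)
      = (\<Prod>x\<in>Inr ` {1..m}. prob (real_family x -` ?A x \<inter> space M))"
    using assms by (intro indep_varsD[OF indep_vars_real_family]) (auto simp: mode_code_image_borel)
  moreover have "(\<Inter>x\<in>Inr ` {1..m}. real_family x -` ?A x \<inter> space M) = mode_event C \<inter> space M"
    using assms by (auto simp: mode_event_def image_iff)
  moreover have "prob (real_family (Inr k) -` ?A (Inr k) \<inter> space M) = measure_pmf.prob (mode_pmf n p) (C k)"
    if "k \<in> {1..m}" for k
  proof -
    have "real_family (Inr k) -` ?A (Inr k) \<inter> space M = mode k -` C k \<inter> space M"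
      by (auto simp: image_iff)
    then show ?thesis using prob_mode[OF that] by simp
  qed
  ultimately show ?thesis
    by (simp add: prod.reindex)
qed

text \<open>Modes and SNRs occupy the disjoint blocks \<open>Inr\<close> and \<open>Inl\<close> of
  one independent family, and functions of disjoint blocks are independent. Taking \<open>F\<close>
  on the whole array of links lets the same statement serve every rate.\<close>

lemma mode_event_SNR_independent:
  fixes F :: "(transmitter \<times> receiver \<Rightarrow> real) \<Rightarrow> real"
  assumes F: "F \<in> borel_measurable (Pi\<^sub>M links (\<lambda>_. borel))"
  shows "indep_var borel (indicator (mode_event C)) borel (\<lambda>\<omega>. F (\<lambda>(a, b)\<in>links. SNR a b \<omega>))"
proof -
  let ?A = "Inr ` {1..m} :: ((transmitter \<times> receiver) + nat) set"
  let ?B = "Inl ` links :: ((transmitter \<times> receiver) + nat) set"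
  \<comment> \<open>The family contains only coded modes, so membership in \<open>C k\<close> is
    tested on codes; injectivity of \<open>mode_code\<close> makes the two tests agree.\<close>
  let ?f = "\<lambda>h. if \<forall>k\<in>{1..m}. h (Inr k) \<in> mode_code ` C k then 1 else 0 :: real"
  let ?g = "\<lambda>h. F (\<lambda>l\<in>links. h (Inl l))"
  have f: "?f \<in> borel_measurable (Pi\<^sub>M ?A (\<lambda>_. borel))"
  proof -
    have [measurable]: "Measurable.pred (Pi\<^sub>M ?A (\<lambda>_. borel)) (\<lambda>h. h (Inr k) \<in> mode_code ` C k)"
      if "k \<in> {1..m}" for k
      by (rule pred_sets2[OF mode_code_image_borel])
         (use that in \<open>auto intro!: measurable_component_singleton\<close>)
    show ?thesis by measurable
  qed
  have g: "?g \<in> borel_measurable (Pi\<^sub>M ?B (\<lambda>_. borel))"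
    by (rule measurable_compose[OF _ F])
       (auto intro!: measurable_restrict measurable_component_singleton)
  have "indep_var borel (?f \<circ> (\<lambda>\<omega>. restrict (\<lambda>x. real_family x \<omega>) ?A))
                  borel (?g \<circ> (\<lambda>\<omega>. restrict (\<lambda>x. real_family x \<omega>) ?B))"
    by (rule indep_var_compose[OF indep_var_restrict[OF indep_vars_real_family] f g]) auto
  moreover have "?f \<circ> (\<lambda>\<omega>. restrict (\<lambda>x. real_family x \<omega>) ?A) = indicator (mode_event C)"
    by (auto simp: fun_eq_iff mode_event_def image_iff indicator_def)
  moreover have "?g \<circ> (\<lambda>\<omega>. restrict (\<lambda>x. real_family x \<omega>) ?B) = (\<lambda>\<omega>. F (\<lambda>(a, b)\<in>links. SNR a b \<omega>))"
    by (auto simp: fun_eq_iff intro!: arg_cong[where f = F])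
  ultimately show ?thesis by simp
qed

lemma has_bochner_integral_mode_event:
  fixes F :: "(transmitter \<times> receiver \<Rightarrow> real) \<Rightarrow> real"
  assumes F: "F \<in> borel_measurable (Pi\<^sub>M links (\<lambda>_. borel))" and m: "m \<ge> 1"
    and G: "\<And>\<omega>. G \<omega> = F (\<lambda>(a, b)\<in>links. SNR a b \<omega>)" and int: "integrable M G"
  shows "has_bochner_integral M (\<lambda>\<omega>. indicator (mode_event C) \<omega> * G \<omega>)
    ((\<Prod>k=1..m. measure_pmf.prob (mode_pmf n p) (C k)) * expectation G)"
proof -
  have G': "G = (\<lambda>\<omega>. F (\<lambda>(a, b)\<in>links. SNR a b \<omega>))" using G by auto
  have ind: "indep_var borel (indicator (mode_event C)) borel G"
    unfolding G' by (rule mode_event_SNR_independent[OF F])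
  then have m1: "(indicator (mode_event C) :: 'a \<Rightarrow> real) \<in> borel_measurable M"
    by (rule indep_var_rv1)
  have i1: "integrable M (indicator (mode_event C) :: 'a \<Rightarrow> real)"
    by (rule integrable_const_bound[where B = 1]) (use m1 in auto)
  have "expectation (indicator (mode_event C)) = prob (mode_event C \<inter> space M)"
    by simp
  then show ?thesis
    unfolding has_bochner_integral_iff prob_mode_event[OF m, symmetric]
    using indep_var_lebesgue_integral[OF ind i1 int] indep_var_integrable[OF ind i1 int] by simp
qed

end

section \<open>Rates for a fixed mode configuration\<close>

lemma interf_density_nonneg:
  assumes "\<And>k. k \<in> D \<Longrightarrow> 0 < \<gamma> (D2D_Tx k) (D2D_Rx j)" "finite D"
  shows "0 \<le> interf_density \<gamma> j D x"
  unfolding interf_density_def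
  using assms by (intro convolve_nonneg) (auto intro!: exponential_density_nonneg)

context d2d_network
begin

definition interference :: "nat \<Rightarrow> nat set \<Rightarrow> 'a \<Rightarrow> real" where
  "interference j D \<omega> = (\<Sum>k\<in>D. SNR (D2D_Tx k) (D2D_Rx j) \<omega>)"

text \<open>The random set of interferers and the random spectrum share are frozen to
  \<open>D\<close> and \<open>c\<close>. What remains depends on the SNRs alone and is hence
  independent of the modes.\<close>

definition underlay_rate :: "nat \<Rightarrow> nat \<Rightarrow> nat set \<Rightarrow> real \<Rightarrow> 'a \<Rightarrow> real" where
  "underlay_rate j i D c \<omega> = c / real n *
     log 2 (1 + SNR (D2D_Tx j) (D2D_Rx j) \<omega> / (SNR (CUE i) (D2D_Rx j) \<omega> + interference j D \<omega> + 1))"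

definition overlay_rate :: "nat \<Rightarrow> nat \<Rightarrow> real \<Rightarrow> 'a \<Rightarrow> real" where
  "overlay_rate j l c \<omega> = c / real l * log 2 (1 + SNR (D2D_Tx j) (D2D_Rx j) \<omega>)"

lemma link_mem [simp]:
  "k \<in> {1..m} \<Longrightarrow> D2D_Tx k \<in> transmitters n m" "i \<in> {1..n} \<Longrightarrow> CUE i \<in> transmitters n m"
  "k \<in> {1..m} \<Longrightarrow> D2D_Rx k \<in> receivers m"
  by (auto simp: transmitters_def receivers_def)

lemma SNR_nonneg: "a \<in> transmitters n m \<Longrightarrow> b \<in> receivers m \<Longrightarrow> AE \<omega> in M. 0 \<le> SNR a b \<omega>"
  by (rule exponential_AE_nonneg[OF SNR_exponential])

abbreviation own_mean :: "nat \<Rightarrow> real" where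
  "own_mean j \<equiv> \<gamma> (D2D_Tx j) (D2D_Rx j)"

context
  fixes j :: nat
  assumes j: "j \<in> {1..m}"
begin

lemma own_mean_pos: "own_mean j > 0"
  using mean_pos j by simp

lemma interference_nonneg:
  assumes "D \<subseteq> {1..m} - {j}"
  shows "AE \<omega> in M. 0 \<le> interference j D \<omega>"
proof -
  have fin: "finite D" using assms finite_subset by blast
  have "AE \<omega> in M. \<forall>k\<in>D. 0 \<le> SNR (D2D_Tx k) (D2D_Rx j) \<omega>"
    using assms j by (intro AE_finite_allI fin SNR_nonneg) auto
  then show ?thesis
    by (rule eventually_mono) (auto simp: interference_def intro: sum_nonneg)
qed

lemma interference_measurable:
  assumes "D \<subseteq> {1..m} - {j}"
  shows "interference j D \<in> borel_measurable M"
  unfolding interference_def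
  using assms j by (intro borel_measurable_sum SNR_measurable) auto

text \<open>The links involved are pairwise distinct: \<open>j\<close> is not in \<open>D\<close>,
  and a CUE is never a D2D transmitter. The sums therefore run over disjoint parts of
  \<open>real_family\<close>.\<close>

lemma indep_SNR_interference:
  assumes D: "D \<subseteq> {1..m} - {j}" and i: "i \<in> {1..n}"
  shows "indep_var borel (SNR (D2D_Tx j) (D2D_Rx j)) borel
           (\<lambda>\<omega>. SNR (CUE i) (D2D_Rx j) \<omega> + interference j D \<omega>)"
    and "indep_var borel (SNR (CUE i) (D2D_Rx j)) borel (interference j D)"
proof -
  let ?x = "Inl (D2D_Tx j, D2D_Rx j) :: (transmitter \<times> receiver) + nat"
  let ?y = "Inl (CUE i, D2D_Rx j) :: (transmitter \<times> receiver) + nat"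
  let ?s = "\<lambda>k. Inl (D2D_Tx k, D2D_Rx j) :: (transmitter \<times> receiver) + nat"
  have fin: "finite D" using D finite_subset by blast
  have inj: "inj_on ?s D" by (rule inj_onI) simp
  have sub: "{?x, ?y} \<union> ?s ` D \<subseteq> links <+> {1..m}"
    using D i j by auto
  have S: "(\<Sum>x\<in>?s ` D. real_family x \<omega>) = interference j D \<omega>" for \<omega>
    by (simp add: sum.reindex[OF inj] interference_def)
  have "indep_var borel (real_family ?x) borel (\<lambda>\<omega>. \<Sum>x\<in>insert ?y (?s ` D). real_family x \<omega>)"
    using D fin
    by (intro indep_vars_sum indep_vars_subset[OF indep_vars_real_family]) (use sub in auto)
  moreover have "(\<Sum>x\<in>insert ?y (?s ` D). real_family x \<omega>)
      = SNR (CUE i) (D2D_Rx j) \<omega> + interference j D \<omega>" for \<omega>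
    using fin by (subst sum.insert) (auto simp: S)
  ultimately show "indep_var borel (SNR (D2D_Tx j) (D2D_Rx j)) borel
           (\<lambda>\<omega>. SNR (CUE i) (D2D_Rx j) \<omega> + interference j D \<omega>)"
    by simp
  have "indep_var borel (real_family ?y) borel (\<lambda>\<omega>. \<Sum>x\<in>?s ` D. real_family x \<omega>)"
    using fin
    by (intro indep_vars_sum indep_vars_subset[OF indep_vars_real_family]) (use sub in auto)
  then show "indep_var borel (SNR (CUE i) (D2D_Rx j)) borel (interference j D)"
    unfolding S by simp
qed

text \<open>Without interferers the sum is the constant 0, which has no density; this is the origin
  of the case \<open>D = {}\<close> in \<open>Omega\<close> and \<open>Delta\<close>.\<close>

lemma expectation_interference:
  fixes g :: "real \<Rightarrow> real"
  assumes D: "D \<subseteq> {1..m} - {j}" and g [measurable]: "g \<in> borel_measurable borel"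
  shows "expectation (\<lambda>\<omega>. g (interference j D \<omega>))
    = (if D = {} then g 0 else (LBINT x:{0..}. g x * interf_density \<gamma> j D x))"
proof (cases "D = {}")
  case True
  then show ?thesis by (simp add: interference_def prob_space)
next
  case False
  have fin: "finite D" using D finite_subset by blast
  have [measurable]: "interference j D \<in> borel_measurable M"
    by (rule interference_measurable[OF D])
  have dist: "distributed M lborel (interference j D) (interf_density \<gamma> j D)"
    using interference_density[OF j _ False] D by (auto simp: interference_def[abs_def])
  have nonneg: "0 \<le> interf_density \<gamma> j D x" for x
    using D j fin by (intro interf_density_nonneg mean_pos) auto
  \<comment> \<open>Interference is almost surely nonnegative, so the indicator that restricts the
    integral to \<open>{0..}\<close> may be inserted.\<close>
  have "expectation (\<lambda>\<omega>. g (interference j D \<omega>))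
      = expectation (\<lambda>\<omega>. indicator {0..} (interference j D \<omega>) * g (interference j D \<omega>))"
    using interference_nonneg[OF D] by (intro integral_cong_AE) auto
  also have "\<dots> = (LBINT x. interf_density \<gamma> j D x * (indicator {0..} x * g x))"
    by (rule distributed_integral[OF dist, symmetric]) (auto simp: nonneg)
  also have "\<dots> = (LBINT x:{0..}. g x * interf_density \<gamma> j D x)"
    by (simp add: set_lebesgue_integral_def mult_ac)
  finally show ?thesis using False by simp
qed

lemma underlay_rate_measurable:
  assumes "D \<subseteq> {1..m} - {j}" and "i \<in> {1..n}"
  shows "underlay_rate j i D c \<in> borel_measurable M"
proof -
  have [measurable]: "interference j D \<in> borel_measurable M"
    "SNR (D2D_Tx j) (D2D_Rx j) \<in> borel_measurable M" "SNR (CUE i) (D2D_Rx j) \<in> borel_measurable M"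
    using interference_measurable assms j by (auto intro!: SNR_measurable)
  show ?thesis unfolding underlay_rate_def by measurable
qed

lemma overlay_rate_measurable: "overlay_rate j l c \<in> borel_measurable M"
proof -
  have [measurable]: "SNR (D2D_Tx j) (D2D_Rx j) \<in> borel_measurable M"
    using j by (auto intro!: SNR_measurable)
  show ?thesis unfolding overlay_rate_def by measurable
qed

text \<open>Solving (c / n) log2 (1 + X / W) >= r for \<open>X\<close> gives X >= t W with
  \<open>t = 2 powr (n * r / c) - 1\<close>. For \<open>c = 0\<close> and \<open>r > 0\<close> the
  rate is 0 and never reaches \<open>r\<close>, in agreement with the value 0 fixed in
  \<open>Omega\<close>.\<close>

lemma prob_underlay_rate_ge:
  assumes D: "D \<subseteq> {1..m} - {j}" and i: "i \<in> {1..n}" and c: "0 \<le> c" and r: "0 \<le> r"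
  shows "prob {\<omega> \<in> space M. r \<le> underlay_rate j i D c \<omega>} = Omega n r \<gamma> i j D c"
proof (cases "c = 0 \<and> r > 0")
  case True
  then show ?thesis by (auto simp: underlay_rate_def Omega_def)
next
  case False
  let ?X = "SNR (D2D_Tx j) (D2D_Rx j)" and ?Y = "SNR (CUE i) (D2D_Rx j)" and ?S = "interference j D"
  let ?a = "\<gamma> (CUE i) (D2D_Rx j)"
  define t where "t = 2 powr (real n * r / c) - 1"
  have t: "t \<ge> 0" using c r by (simp add: t_def ge_one_powr_ge_zero)
  have [measurable]: "?X \<in> borel_measurable M" "?Y \<in> borel_measurable M" "?S \<in> borel_measurable M"
    using j i interference_measurable[OF D] by (auto intro!: SNR_measurable)
  have [measurable]: "underlay_rate j i D c \<in> borel_measurable M"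
    by (rule underlay_rate_measurable[OF D i])
  have X: "distributed M lborel ?X (exponential_density (1 / own_mean j))"
    and Y: "distributed M lborel ?Y (exponential_density (1 / ?a))"
    using j i by (auto intro!: SNR_exponential)
  have "AE \<omega> in M. r \<le> underlay_rate j i D c \<omega> \<longleftrightarrow> t * (?Y \<omega> + ?S \<omega> + 1) \<le> ?X \<omega>"
    using exponential_AE_nonneg[OF X] exponential_AE_nonneg[OF Y] interference_nonneg[OF D]
  proof eventually_elim
    case (elim \<omega>)
    define W where "W = ?Y \<omega> + ?S \<omega> + 1"
    have W: "W > 0" using elim by (simp add: W_def)
    then have q: "1 + ?X \<omega> / W > 0" using elim by (simp add: add_pos_nonneg)
    show ?case
    proof (cases "c = 0")
      \<comment> \<open>Only \<open>r = 0\<close> remains here. Then the rate and \<open>t\<close>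
        are both 0, and each side of the equivalence holds.\<close>
      case True
      then have "r = 0" using False r by simp
      then show ?thesis using True elim n_pos by (simp add: underlay_rate_def t_def)
    next
      case c0: False
      then have "c > 0" using c by simp
      then have "r \<le> underlay_rate j i D c \<omega> \<longleftrightarrow> real n * r / c \<le> log 2 (1 + ?X \<omega> / W)"
        using n_pos by (simp add: underlay_rate_def W_def field_simps)
      also have "\<dots> \<longleftrightarrow> 2 powr (real n * r / c) \<le> 1 + ?X \<omega> / W"
        using q by (intro le_log_iff) auto
      also have "\<dots> \<longleftrightarrow> t * W \<le> ?X \<omega>"
        using W by (simp add: t_def field_simps)
      finally show ?thesis by (simp add: W_def)
    qed
  qed
  then have "prob {\<omega> \<in> space M. r \<le> underlay_rate j i D c \<omega>}
      = prob {\<omega> \<in> space M. t * (?Y \<omega> + ?S \<omega> + 1) \<le> ?X \<omega>}"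
    by (intro finite_measure_eq_AE) auto
  also have "\<dots> = expectation (\<lambda>\<omega>. exp (- (t * (?S \<omega> + 1)) / own_mean j)) / (?a / own_mean j * t + 1)"
    using indep_SNR_interference[OF D i] interference_nonneg[OF D] t i j
    by (intro prob_sinr_ge[OF X Y]) (auto intro!: mean_pos)
  also have "expectation (\<lambda>\<omega>. exp (- (t * (?S \<omega> + 1)) / own_mean j))
      = (if D = {} then exp (- (t * (0 + 1)) / own_mean j)
         else (LBINT x:{0..}. exp (- (t * (x + 1)) / own_mean j) * interf_density \<gamma> j D x))"
    by (rule expectation_interference[OF D]) measurable
  finally show ?thesis
    using False by (auto simp: Omega_def Let_def t_def[symmetric])
qed

lemma has_bochner_integral_underlay_rate:
  assumes D: "D \<subseteq> {1..m} - {j}" and i: "i \<in> {1..n}" and ne: "\<gamma> (CUE i) (D2D_Rx j) \<noteq> own_mean j"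
  shows "has_bochner_integral M (underlay_rate j i D c)
    (c * (Delta \<gamma> i j D / (real n * ln 2 * (\<gamma> (CUE i) (D2D_Rx j) / own_mean j - 1))))"
proof -
  let ?X = "SNR (D2D_Tx j) (D2D_Rx j)" and ?Y = "SNR (CUE i) (D2D_Rx j)" and ?S = "interference j D"
  let ?a = "\<gamma> (CUE i) (D2D_Rx j)"
  let ?P = "\<lambda>x. Psi ((x + 1) / own_mean j) - Psi ((x + 1) / ?a)"
  have X: "distributed M lborel ?X (exponential_density (1 / own_mean j))"
    and Y: "distributed M lborel ?Y (exponential_density (1 / ?a))"
    using j i by (auto intro!: SNR_exponential)
  have "has_bochner_integral M (\<lambda>\<omega>. ln (1 + ?X \<omega> / (?Y \<omega> + ?S \<omega> + 1)))
      (expectation (\<lambda>\<omega>. ?P (?S \<omega>) / (?a / own_mean j - 1)))"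
    using indep_SNR_interference[OF D i] interference_nonneg[OF D] i j ne
    by (intro expectation_ln_sinr[OF X Y]) (auto intro!: mean_pos)
  moreover have "expectation (\<lambda>\<omega>. ?P (?S \<omega>) / (?a / own_mean j - 1)) = Delta \<gamma> i j D / (?a / own_mean j - 1)"
    using expectation_interference[OF D, of ?P]
    by (simp add: Delta_def Let_def mult.commute)
  ultimately have "has_bochner_integral M (\<lambda>\<omega>. ln (1 + ?X \<omega> / (?Y \<omega> + ?S \<omega> + 1)))
      (Delta \<gamma> i j D / (?a / own_mean j - 1))"
    by (simp only:)
  then have "has_bochner_integral M
      (\<lambda>\<omega>. (c / real n / ln 2) * ln (1 + ?X \<omega> / (?Y \<omega> + ?S \<omega> + 1)))
      ((c / real n / ln 2) * (Delta \<gamma> i j D / (?a / own_mean j - 1)))"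
    by (rule has_bochner_integral_mult_right)
  then show ?thesis
    by (simp add: underlay_rate_def[abs_def] log_def mult.assoc)
qed

lemma prob_overlay_rate_ge:
  assumes l: "l \<ge> 1" and c: "0 \<le> c" and r: "0 \<le> r"
  shows "prob {\<omega> \<in> space M. r \<le> overlay_rate j l c \<omega>} = exp_threshold (real l * r) c (own_mean j)"
proof (cases "c = 0 \<and> real l * r > 0")
  case True
  then show ?thesis using l by (auto simp: overlay_rate_def exp_threshold_def zero_less_mult_iff)
next
  case False
  let ?X = "SNR (D2D_Tx j) (D2D_Rx j)"
  define t where "t = 2 powr (real l * r / c) - 1"
  have t: "t \<ge> 0" using c r by (simp add: t_def ge_one_powr_ge_zero)
  have [measurable]: "?X \<in> borel_measurable M" using j by (auto intro!: SNR_measurable)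
  have [measurable]: "overlay_rate j l c \<in> borel_measurable M" by (rule overlay_rate_measurable)
  have X: "distributed M lborel ?X (exponential_density (1 / own_mean j))"
    using j by (auto intro!: SNR_exponential)
  have "AE \<omega> in M. r \<le> overlay_rate j l c \<omega> \<longleftrightarrow> t \<le> ?X \<omega>"
    using exponential_AE_nonneg[OF X]
  proof eventually_elim
    case (elim \<omega>)
    show ?case
    proof (cases "c = 0")
      case True
      then have "r = 0" using False r l by (simp add: zero_less_mult_iff)
      then show ?thesis using True elim by (simp add: overlay_rate_def t_def)
    next
      case c0: False
      then have "c > 0" using c by simp
      then have "r \<le> overlay_rate j l c \<omega> \<longleftrightarrow> real l * r / c \<le> log 2 (1 + ?X \<omega>)"
        using l by (simp add: overlay_rate_def field_simps)
      also have "\<dots> \<longleftrightarrow> 2 powr (real l * r / c) \<le> 1 + ?X \<omega>"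
        using elim by (intro le_log_iff) auto
      also have "\<dots> \<longleftrightarrow> t \<le> ?X \<omega>" by (auto simp: t_def)
      finally show ?thesis .
    qed
  qed
  then have "prob {\<omega> \<in> space M. r \<le> overlay_rate j l c \<omega>} = prob {\<omega> \<in> space M. t \<le> ?X \<omega>}"
    by (intro finite_measure_eq_AE) auto
  also have "\<dots> = exp (- t * (1 / own_mean j))"
    using t own_mean_pos by (intro exponential_tail[OF X]) auto
  finally show ?thesis
    using False by (auto simp: exp_threshold_def t_def)
qed

lemma has_bochner_integral_overlay_rate:
  "has_bochner_integral M (overlay_rate j l c) (c / real l * (- Psi (1 / own_mean j) / ln 2))"
proof -
  have X: "distributed M lborel (SNR (D2D_Tx j) (D2D_Rx j)) (exponential_density (1 / own_mean j))"
    using j by (auto intro!: SNR_exponential)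
  show ?thesis
    unfolding overlay_rate_def[abs_def] log_def
    using expectation_ln_snr[OF X own_mean_pos]
    by (intro has_bochner_integral_mult_right has_bochner_integral_divide_zero) simp
qed

end

end

section \<open>Averaging over the mode configurations\<close>

context d2d_network
begin

context
  fixes j :: nat
  assumes j: "j \<in> {1..m}"
begin

lemma mode_pred_measurable:
  "k \<in> {1..m} \<Longrightarrow> Measurable.pred M (\<lambda>\<omega>. mode k \<omega> = c)"
  by (rule measurable_compose[OF mode_measurable]) simp_all

lemma mode_sets: "{\<omega> \<in> space M. mode j \<omega> = c} \<in> events"
  using mode_pred_measurable[OF j] by (simp add: pred_def)

lemma underlay_capacity_measurable:
  assumes i: "i \<in> {1..n}"
  shows "underlay_capacity n m \<beta> SNR mode j i \<in> borel_measurable M"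
proof -
  have [measurable]: "SNR (CUE i) (D2D_Rx j) \<in> borel_measurable M"
    using i j by (auto intro!: SNR_measurable)
  have [measurable]: "SNR (D2D_Tx k) (D2D_Rx j) \<in> borel_measurable M" if "k \<in> {1..m}" for k
    using that j by (auto intro!: SNR_measurable)
  have [measurable]: "SNR (D2D_Tx j) (D2D_Rx j) \<in> borel_measurable M"
    using j by (auto intro!: SNR_measurable)
  have [measurable]: "Measurable.pred M (\<lambda>\<omega>. mode k \<omega> = c)" if "k \<in> {1..m}" for k c
    by (rule mode_pred_measurable[OF that])
  have c: "cue_fraction m \<beta> mode \<omega> = (if \<exists>k\<in>{1..m}. mode k \<omega> = Overlay then \<beta> else 1)" for \<omega>
    by (auto simp: cue_fraction_def overlay_set_def)
  \<comment> \<open>Trading the random index set for the fixed set \<open>{1..m}\<close> with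
    vanishing summands makes the sum measurable term by term.\<close>
  have s: "(\<Sum>k\<in>underlay_set m mode i \<omega> - {j}. SNR (D2D_Tx k) (D2D_Rx j) \<omega>)
      = (\<Sum>k\<in>{1..m}. if mode k \<omega> = Underlay i \<and> k \<noteq> j then SNR (D2D_Tx k) (D2D_Rx j) \<omega> else 0)" for \<omega>
    by (rule sum.mono_neutral_cong_left) (auto simp: underlay_set_def)
  show ?thesis
    unfolding underlay_capacity_def c s by measurable
qed

lemma overlay_capacity_measurable: "overlay_capacity m \<beta> SNR mode j \<in> borel_measurable M"
proof -
  have [measurable]: "SNR (D2D_Tx j) (D2D_Rx j) \<in> borel_measurable M"
    using j by (auto intro!: SNR_measurable)
  have [measurable]: "Measurable.pred M (\<lambda>\<omega>. mode k \<omega> = c)" if "k \<in> {1..m}" for k c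
    by (rule mode_pred_measurable[OF that])
  have c: "real (card (overlay_set m mode \<omega>)) = (\<Sum>k\<in>{1..m}. if mode k \<omega> = Overlay then 1 else 0)" for \<omega>
    by (simp add: overlay_set_def sum.If_cases Int_def)
  show ?thesis
    unfolding overlay_capacity_def c by measurable
qed

text \<open>For \<open>N = {c}\<close>, \<open>D\<close> is exactly the set of other pairs in mode
  \<open>c\<close>. For \<open>c = Underlay i\<close> and \<open>N = {Underlay i, Overlay}\<close>,
  in addition no pair is overlay.\<close>

definition sharing_event :: "d2d_mode \<Rightarrow> d2d_mode set \<Rightarrow> nat set \<Rightarrow> 'a set" where
  "sharing_event c N D = mode_event (\<lambda>k. if k \<in> insert j D then {c} else - N)"

lemma sharing_event_mode: "\<omega> \<in> sharing_event c N D \<Longrightarrow> mode j \<omega> = c"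
  using j by (force simp: sharing_event_def mode_event_def)

lemma prod_sharing:
  assumes D: "D \<subseteq> {1..m} - {j}"
  shows "(\<Prod>k=1..m. measure_pmf.prob (mode_pmf n p) (if k \<in> insert j D then {c} else - N))
    = measure_pmf.prob (mode_pmf n p) {c} ^ (card D + 1)
      * measure_pmf.prob (mode_pmf n p) (- N) ^ (m - 1 - card D)"
proof -
  have "card (insert j D) = card D + 1"
    using D finite_subset[OF D] by (subst card_insert_disjoint) auto
  moreover have "insert j D \<subseteq> {1..m}" using D j by auto
  ultimately show ?thesis
    using prod_if_mem[of "{1..m}" "insert j D" "measure_pmf.prob (mode_pmf n p) {c}"
        "measure_pmf.prob (mode_pmf n p) (- N)"]
    by (simp add: if_distrib[of "measure_pmf.prob (mode_pmf n p)"] cong: if_cong)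
qed

text \<open>
  Splitting over the set \<open>D\<close> of the other pairs that reuse the spectrum of \<open>A\<^sub>i\<close>; the event that
  some pair is overlay is written as a difference of two events on which the modes are
  constrained separately.
\<close>

lemma underlay_capacity_split:
  "indicator {\<omega>. mode j \<omega> = Underlay i} \<omega> * \<phi> (underlay_capacity n m \<beta> SNR mode j i \<omega>) =
    (\<Sum>D\<in>Pow ({1..m} - {j}).
      indicator (sharing_event (Underlay i) {Underlay i, Overlay} D) \<omega> * \<phi> (underlay_rate j i D 1 \<omega>)
      + (indicator (sharing_event (Underlay i) {Underlay i} D) \<omega> * \<phi> (underlay_rate j i D \<beta> \<omega>)
         - indicator (sharing_event (Underlay i) {Underlay i, Overlay} D) \<omega> * \<phi> (underlay_rate j i D \<beta> \<omega>)) :: real)"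
    (is "?lhs = (\<Sum>D\<in>?P. ?t D)")
proof -
  define U where "U = underlay_set m mode i \<omega> - {j}"
  have U: "U \<in> ?P" by (auto simp: U_def underlay_set_def)
  show ?thesis
  proof (cases "mode j \<omega> = Underlay i")
    case False
    then have "\<omega> \<notin> sharing_event c N D" if "c = Underlay i" for c N D
      using sharing_event_mode that by blast
    then show ?thesis using False by simp
  next
    case True
    have s: "\<omega> \<in> sharing_event (Underlay i) {Underlay i} D \<longleftrightarrow> D = U"
      "\<omega> \<in> sharing_event (Underlay i) {Underlay i, Overlay} D \<longleftrightarrow> D = U \<and> overlay_set m mode \<omega> = {}"
      if "D \<in> ?P" for D
      using that True j
      by (auto simp: sharing_event_def mode_event_def U_def underlay_set_def overlay_set_def
          split: if_splits)
         (metis atLeastAtMost_iff d2d_mode.distinct(1) One_nat_def)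
    \<comment> \<open>Only \<open>D = U\<close> contributes. If no pair is overlay, the two terms
      with \<open>\<beta>\<close> cancel and share 1 is left; otherwise only the middle term
      survives, with share \<open>\<beta>\<close>.\<close>
    have "(\<Sum>D\<in>?P. ?t D) = (\<Sum>D\<in>?P. if D = U then ?lhs else 0)"
      using True
      by (intro sum.cong)
         (auto simp: s indicator_def underlay_capacity_def underlay_rate_def cue_fraction_def
           interference_def U_def[symmetric])
    then show ?thesis using U by simp
  qed
qed

text \<open>Here \<open>D\<close> is the set of other overlay pairs, so the bandwidth is divided by
  \<open>Suc (card D)\<close>, which counts \<open>j\<close> as well. An overlay pair exists, namely
  \<open>j\<close>, so no case distinction on the share arises.\<close>

lemma overlay_capacity_split:
  "indicator {\<omega>. mode j \<omega> = Overlay} \<omega> * \<phi> (overlay_capacity m \<beta> SNR mode j \<omega>) =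
    (\<Sum>D\<in>Pow ({1..m} - {j}). indicator (sharing_event Overlay {Overlay} D) \<omega> *
       (\<phi> (overlay_rate j (Suc (card D)) (1 - \<beta>) \<omega>) :: real))"
    (is "?lhs = (\<Sum>D\<in>?P. ?t D)")
proof -
  define U where "U = overlay_set m mode \<omega> - {j}"
  have U: "U \<in> ?P" by (auto simp: U_def overlay_set_def)
  show ?thesis
  proof (cases "mode j \<omega> = Overlay")
    case False
    then have "\<omega> \<notin> sharing_event c N D" if "c = Overlay" for c N D
      using sharing_event_mode that by blast
    then show ?thesis using False by simp
  next
    case True
    then have "overlay_set m mode \<omega> = insert j U"
      using j by (auto simp: U_def overlay_set_def)
    then have card: "card (overlay_set m mode \<omega>) = Suc (card U)"
      using U finite_subset[of U "{1..m} - {j}"] by (auto simp: card_insert_if)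
    have s: "\<omega> \<in> sharing_event Overlay {Overlay} D \<longleftrightarrow> D = U" if "D \<in> ?P" for D
      using that True j
      by (auto simp: sharing_event_def mode_event_def U_def overlay_set_def split: if_splits)
    have "(\<Sum>D\<in>?P. ?t D) = (\<Sum>D\<in>?P. if D = U then ?lhs else 0)"
      using True
      by (intro sum.cong) (auto simp: s card overlay_capacity_def overlay_rate_def)
    then show ?thesis using U by simp
  qed
qed

lemma has_bochner_integral_sharing_underlay:
  fixes \<phi> :: "real \<Rightarrow> real"
  assumes D: "D \<subseteq> {1..m} - {j}" and i: "i \<in> {1..n}" and \<phi> [measurable]: "\<phi> \<in> borel_measurable borel"
    and int: "integrable M (\<lambda>\<omega>. \<phi> (underlay_rate j i D c \<omega>))"
  shows "has_bochner_integral M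
      (\<lambda>\<omega>. indicator (sharing_event (Underlay i) N D) \<omega> * \<phi> (underlay_rate j i D c \<omega>))
    (measure_pmf.prob (mode_pmf n p) {Underlay i} ^ (card D + 1)
      * measure_pmf.prob (mode_pmf n p) (- N) ^ (m - 1 - card D)
      * expectation (\<lambda>\<omega>. \<phi> (underlay_rate j i D c \<omega>)))"
  unfolding sharing_event_def prod_sharing[OF D, symmetric]
proof (rule has_bochner_integral_mode_event[OF _ _ _ int])
  \<comment> \<open>The rate as a function of the array of all links. Every coordinate read lies in
    \<open>links\<close>, so restricting the array changes nothing.\<close>
  let ?F = "\<lambda>f. \<phi> (c / real n * log 2 (1 + f (D2D_Tx j, D2D_Rx j)
      / (f (CUE i, D2D_Rx j) + (\<Sum>k\<in>D. f (D2D_Tx k, D2D_Rx j)) + 1)))"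
  have [measurable]: "(\<lambda>f. f (D2D_Tx j, D2D_Rx j)) \<in> borel_measurable (Pi\<^sub>M links (\<lambda>_. borel :: real measure))"
    "(\<lambda>f. f (CUE i, D2D_Rx j)) \<in> borel_measurable (Pi\<^sub>M links (\<lambda>_. borel :: real measure))"
    using i j by (auto intro!: measurable_component_singleton)
  have [measurable]: "(\<lambda>f. \<Sum>k\<in>D. f (D2D_Tx k, D2D_Rx j)) \<in> borel_measurable (Pi\<^sub>M links (\<lambda>_. borel :: real measure))"
    using D j by (intro borel_measurable_sum measurable_component_singleton) auto
  show "?F \<in> borel_measurable (Pi\<^sub>M links (\<lambda>_. borel))" by measurable
  show "m \<ge> 1" using j by auto
  show "\<phi> (underlay_rate j i D c \<omega>) = ?F (\<lambda>(a, b)\<in>links. SNR a b \<omega>)" for \<omega>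
  proof -
    have "interference j D \<omega> = (\<Sum>k\<in>D. (\<lambda>(a, b)\<in>links. SNR a b \<omega>) (D2D_Tx k, D2D_Rx j))"
      unfolding interference_def using D j by (intro sum.cong) auto
    then show ?thesis using i j by (simp add: underlay_rate_def)
  qed
qed

lemma has_bochner_integral_sharing_overlay:
  fixes \<phi> :: "real \<Rightarrow> real"
  assumes D: "D \<subseteq> {1..m} - {j}" and \<phi> [measurable]: "\<phi> \<in> borel_measurable borel"
    and int: "integrable M (\<lambda>\<omega>. \<phi> (overlay_rate j l c \<omega>))"
  shows "has_bochner_integral M
      (\<lambda>\<omega>. indicator (sharing_event Overlay N D) \<omega> * \<phi> (overlay_rate j l c \<omega>))
    (measure_pmf.prob (mode_pmf n p) {Overlay} ^ (card D + 1)
      * measure_pmf.prob (mode_pmf n p) (- N) ^ (m - 1 - card D)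
      * expectation (\<lambda>\<omega>. \<phi> (overlay_rate j l c \<omega>)))"
  unfolding sharing_event_def prod_sharing[OF D, symmetric]
proof (rule has_bochner_integral_mode_event[OF _ _ _ int])
  let ?F = "\<lambda>f. \<phi> (c / real l * log 2 (1 + f (D2D_Tx j, D2D_Rx j)))"
  have [measurable]: "(\<lambda>f. f (D2D_Tx j, D2D_Rx j)) \<in> borel_measurable (Pi\<^sub>M links (\<lambda>_. borel :: real measure))"
    using j by (auto intro!: measurable_component_singleton)
  show "?F \<in> borel_measurable (Pi\<^sub>M links (\<lambda>_. borel))" by measurable
  show "m \<ge> 1" using j by auto
  show "\<phi> (overlay_rate j l c \<omega>) = ?F (\<lambda>(a, b)\<in>links. SNR a b \<omega>)" for \<omega>
    using j by (simp add: overlay_rate_def)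
qed

text \<open>After regrouping, the weight of share 1 is the probability that \<open>D\<close> is the
  set of sharers and nobody is overlay; the weight of share \<open>\<beta>\<close> is the
  probability that \<open>D\<close> is the set of sharers and somebody is overlay. Both include that
  \<open>j\<close> itself is on the spectrum of CUE \<open>i\<close>, whence the exponent
  \<open>card D + 1\<close>.\<close>

lemma expectation_underlay_capacity:
  fixes \<phi> :: "real \<Rightarrow> real"
  assumes i: "i \<in> {1..n}" and \<phi>: "\<phi> \<in> borel_measurable borel"
    and int: "\<And>D c. D \<subseteq> {1..m} - {j} \<Longrightarrow> integrable M (\<lambda>\<omega>. \<phi> (underlay_rate j i D c \<omega>))"
  shows "expectation (\<lambda>\<omega>. indicator {\<omega> \<in> space M. mode j \<omega> = Underlay i} \<omega>
            * \<phi> (underlay_capacity n m \<beta> SNR mode j i \<omega>)) =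
    (\<Sum>D\<in>Pow ({1..m} - {j}). (p / real n) ^ (card D + 1) *
      ((p * (1 - 1 / real n)) ^ (m - 1 - card D) * expectation (\<lambda>\<omega>. \<phi> (underlay_rate j i D 1 \<omega>))
       + ((1 - p / real n) ^ (m - 1 - card D) - (p * (1 - 1 / real n)) ^ (m - 1 - card D))
         * expectation (\<lambda>\<omega>. \<phi> (underlay_rate j i D \<beta> \<omega>))))"
proof -
  let ?\<epsilon> = "p / real n" and ?\<theta> = "p * (1 - 1 / real n)"
  let ?E = "\<lambda>D c. expectation (\<lambda>\<omega>. \<phi> (underlay_rate j i D c \<omega>))"
  note P = prob_mode_pmf[OF p_nonneg p_le_1 i]
  have "has_bochner_integral M (\<lambda>\<omega>. indicator {\<omega>. mode j \<omega> = Underlay i} \<omega>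
            * \<phi> (underlay_capacity n m \<beta> SNR mode j i \<omega>))
    (\<Sum>D\<in>Pow ({1..m} - {j}). ?\<epsilon> ^ (card D + 1) * ?\<theta> ^ (m - 1 - card D) * ?E D 1
      + (?\<epsilon> ^ (card D + 1) * (1 - ?\<epsilon>) ^ (m - 1 - card D) * ?E D \<beta>
         - ?\<epsilon> ^ (card D + 1) * ?\<theta> ^ (m - 1 - card D) * ?E D \<beta>))"
    unfolding underlay_capacity_split
  proof (intro has_bochner_integral_sum has_bochner_integral_add has_bochner_integral_diff)
    fix D assume "D \<in> Pow ({1..m} - {j})"
    then have D: "D \<subseteq> {1..m} - {j}" by auto
    note H = has_bochner_integral_sharing_underlay[OF D i \<phi> int[OF D]]
    show "has_bochner_integral M
        (\<lambda>\<omega>. indicator (sharing_event (Underlay i) {Underlay i, Overlay} D) \<omega> * \<phi> (underlay_rate j i D c \<omega>))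
        (?\<epsilon> ^ (card D + 1) * ?\<theta> ^ (m - 1 - card D) * ?E D c)" for c
      using H[of "{Underlay i, Overlay}" c] by (simp only: P)
    then show "has_bochner_integral M
        (\<lambda>\<omega>. indicator (sharing_event (Underlay i) {Underlay i, Overlay} D) \<omega> * \<phi> (underlay_rate j i D \<beta> \<omega>))
        (?\<epsilon> ^ (card D + 1) * ?\<theta> ^ (m - 1 - card D) * ?E D \<beta>)" .
    show "has_bochner_integral M
        (\<lambda>\<omega>. indicator (sharing_event (Underlay i) {Underlay i} D) \<omega> * \<phi> (underlay_rate j i D \<beta> \<omega>))
        (?\<epsilon> ^ (card D + 1) * (1 - ?\<epsilon>) ^ (m - 1 - card D) * ?E D \<beta>)"
      using H[of "{Underlay i}" \<beta>] by (simp only: P)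
  qed
  then have "expectation (\<lambda>\<omega>. indicator {\<omega>. mode j \<omega> = Underlay i} \<omega>
            * \<phi> (underlay_capacity n m \<beta> SNR mode j i \<omega>)) =
    (\<Sum>D\<in>Pow ({1..m} - {j}). ?\<epsilon> ^ (card D + 1) * ?\<theta> ^ (m - 1 - card D) * ?E D 1
      + (?\<epsilon> ^ (card D + 1) * (1 - ?\<epsilon>) ^ (m - 1 - card D) * ?E D \<beta>
         - ?\<epsilon> ^ (card D + 1) * ?\<theta> ^ (m - 1 - card D) * ?E D \<beta>))"
    by (rule has_bochner_integral_integral_eq)
  also have "expectation (\<lambda>\<omega>. indicator {\<omega>. mode j \<omega> = Underlay i} \<omega>
            * \<phi> (underlay_capacity n m \<beta> SNR mode j i \<omega>)) =
      expectation (\<lambda>\<omega>. indicator {\<omega> \<in> space M. mode j \<omega> = Underlay i} \<omega>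
            * \<phi> (underlay_capacity n m \<beta> SNR mode j i \<omega>))"
    by (rule Bochner_Integration.integral_cong) (auto simp: indicator_def)
  finally show ?thesis
    by (simp only: distrib_left left_diff_distrib right_diff_distrib mult.assoc)
qed

lemma expectation_overlay_capacity:
  fixes \<phi> :: "real \<Rightarrow> real"
  assumes \<phi>: "\<phi> \<in> borel_measurable borel"
    and int: "\<And>l. integrable M (\<lambda>\<omega>. \<phi> (overlay_rate j l (1 - \<beta>) \<omega>))"
  shows "expectation (\<lambda>\<omega>. indicator {\<omega> \<in> space M. mode j \<omega> = Overlay} \<omega>
            * \<phi> (overlay_capacity m \<beta> SNR mode j \<omega>)) =
    (\<Sum>l=1..m. real ((m - 1) choose (l - 1)) * p ^ (m - l) * (1 - p) ^ l
        * expectation (\<lambda>\<omega>. \<phi> (overlay_rate j l (1 - \<beta>) \<omega>)))"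
proof -
  let ?E = "\<lambda>l. expectation (\<lambda>\<omega>. \<phi> (overlay_rate j l (1 - \<beta>) \<omega>))"
  have one: "1 \<in> {1..n}" using n_pos by simp
  note P = prob_mode_pmf[OF p_nonneg p_le_1 one]
  have "has_bochner_integral M (\<lambda>\<omega>. indicator {\<omega>. mode j \<omega> = Overlay} \<omega>
            * \<phi> (overlay_capacity m \<beta> SNR mode j \<omega>))
    (\<Sum>D\<in>Pow ({1..m} - {j}). (1 - p) ^ (card D + 1) * p ^ (m - 1 - card D) * ?E (Suc (card D)))"
    unfolding overlay_capacity_split
  proof (rule has_bochner_integral_sum)
    fix D assume "D \<in> Pow ({1..m} - {j})"
    then have D: "D \<subseteq> {1..m} - {j}" by auto
    show "has_bochner_integral M
        (\<lambda>\<omega>. indicator (sharing_event Overlay {Overlay} D) \<omega> * \<phi> (overlay_rate j (Suc (card D)) (1 - \<beta>) \<omega>))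
        ((1 - p) ^ (card D + 1) * p ^ (m - 1 - card D) * ?E (Suc (card D)))"
      using has_bochner_integral_sharing_overlay[OF D \<phi> int, of "{Overlay}" "Suc (card D)"]
      by (simp only: P)
  qed
  then have "expectation (\<lambda>\<omega>. indicator {\<omega>. mode j \<omega> = Overlay} \<omega>
            * \<phi> (overlay_capacity m \<beta> SNR mode j \<omega>)) =
    (\<Sum>D\<in>Pow ({1..m} - {j}). (1 - p) ^ (card D + 1) * p ^ (m - 1 - card D) * ?E (Suc (card D)))"
    by (rule has_bochner_integral_integral_eq)
  also have "\<dots> = (\<Sum>k\<le>m - 1. real ((m - 1) choose k) *
      ((1 - p) ^ (k + 1) * p ^ (m - 1 - k) * ?E (Suc k)))"
    using sum_Pow_card[of "{1..m} - {j}" "\<lambda>k. (1 - p) ^ (k + 1) * p ^ (m - 1 - k) * ?E (Suc k)"] j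
    by simp
  \<comment> \<open>This uses \<open>m \<ge> 1\<close>, which follows from the existence of
    \<open>j\<close>. The shift \<open>l = k + 1\<close> then turns the number of other overlay
    pairs into the number of all of them.\<close>
  also have "{..m - 1} = {..<m}" using j by auto
  also have "(\<Sum>k<m. real ((m - 1) choose k) * ((1 - p) ^ (k + 1) * p ^ (m - 1 - k) * ?E (Suc k)))
      = (\<Sum>l=1..m. real ((m - 1) choose (l - 1)) * p ^ (m - l) * (1 - p) ^ l * ?E l)"
    by (simp add: sum.atLeast1_atMost_eq mult_ac)
  also have "expectation (\<lambda>\<omega>. indicator {\<omega>. mode j \<omega> = Overlay} \<omega>
            * \<phi> (overlay_capacity m \<beta> SNR mode j \<omega>)) =
      expectation (\<lambda>\<omega>. indicator {\<omega> \<in> space M. mode j \<omega> = Overlay} \<omega>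
            * \<phi> (overlay_capacity m \<beta> SNR mode j \<omega>))"
    by (rule Bochner_Integration.integral_cong) (auto simp: indicator_def)
  finally show ?thesis .
qed

section \<open>From conditional laws to the two closed forms\<close>

lemma prob_mode_eq: "prob {\<omega> \<in> space M. mode j \<omega> = c} = measure_pmf.prob (mode_pmf n p) {c}"
  using prob_mode[OF j, of "{c}"] by (simp add: vimage_def Int_def conj_commute)

text \<open>The event that mode \<open>c\<close> is chosen splits into outage and success; only the
  success part is computed further.\<close>

lemma given_mode_outage:
  fixes R :: "'a \<Rightarrow> real"
  assumes [measurable]: "R \<in> borel_measurable M"
  shows "measure_pmf.prob (mode_pmf n p) {c} * measure (given_mode M mode j c) {\<omega> \<in> space M. R \<omega> < r}
    = measure_pmf.prob (mode_pmf n p) {c}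
      - expectation (\<lambda>\<omega>. indicator {\<omega> \<in> space M. mode j \<omega> = c} \<omega> * indicator {r..} (R \<omega>))"
proof -
  let ?A = "{\<omega> \<in> space M. mode j \<omega> = c}" and ?B = "{\<omega> \<in> space M. R \<omega> < r}" and ?C = "{\<omega> \<in> space M. r \<le> R \<omega>}"
  have A [measurable]: "?A \<in> events" by (rule mode_sets)
  have "expectation (\<lambda>\<omega>. indicator ?A \<omega> * indicator {r..} (R \<omega>) :: real) = expectation (indicator (?A \<inter> ?C))"
    by (rule Bochner_Integration.integral_cong) (auto simp: indicator_def)
  also have "\<dots> = prob (?A \<inter> ?C)"
  proof -
    have "?A \<inter> ?C \<inter> space M = ?A \<inter> ?C" by auto
    then show ?thesis by simp
  qed
  also have "prob ?A = prob (?A \<inter> ?B) + prob (?A \<inter> ?C)"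
    by (subst finite_measure_Union[symmetric]) (auto intro!: arg_cong[where f = prob])
  ultimately show ?thesis
    using measure_uniform_measure_times[OF A, of ?B]
    by (simp add: prob_mode_eq[symmetric] given_mode_def)
qed

lemma given_mode_expectation:
  fixes R :: "'a \<Rightarrow> real"
  assumes "R \<in> borel_measurable M"
  shows "measure_pmf.prob (mode_pmf n p) {c} * integral\<^sup>L (given_mode M mode j c) R
    = expectation (\<lambda>\<omega>. indicator {\<omega> \<in> space M. mode j \<omega> = c} \<omega> * R \<omega>)"
  unfolding prob_mode_eq[symmetric] given_mode_def
  by (rule integral_uniform_measure_times[OF mode_sets assms])

text \<open>The leading 1 is the total weight of the modes, \<open>n\<close> times
  \<open>p / n\<close> plus \<open>1 - p\<close>; the sums subtracted from it are the success
  probabilities.\<close>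

lemma outage_formula:
  assumes \<beta>: "0 \<le> \<beta>" "\<beta> \<le> 1" and r: "0 \<le> r"
  shows "outage_probability M n m p \<beta> r SNR mode j =
      1 - (\<Sum>l=1..m. real ((m - 1) choose (l - 1)) * p ^ (m - l) * (1 - p) ^ l
                       * exp_threshold (real l * r) (1 - \<beta>) (own_mean j))
        - (\<Sum>i=1..n. \<Sum>D\<in>Pow ({1..m} - {j}). (p / real n) ^ (card D + 1) *
             ((p * (1 - 1 / real n)) ^ (m - 1 - card D) * Omega n r \<gamma> i j D 1
              + ((1 - p / real n) ^ (m - 1 - card D) - (p * (1 - 1 / real n)) ^ (m - 1 - card D))
                * Omega n r \<gamma> i j D \<beta>))"
    (is "_ = 1 - ?O - (\<Sum>i=1..n. ?U i)")
proof -
  let ?\<phi> = "indicator {r..} :: real \<Rightarrow> real"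
  have E: "integrable M (\<lambda>\<omega>. ?\<phi> (R \<omega>))" "expectation (\<lambda>\<omega>. ?\<phi> (R \<omega>)) = prob {\<omega> \<in> space M. r \<le> R \<omega>}"
    if [measurable]: "R \<in> borel_measurable M" for R :: "'a \<Rightarrow> real"
  proof -
    show "integrable M (\<lambda>\<omega>. ?\<phi> (R \<omega>))"
      by (rule integrable_const_bound[where B = 1]) (auto simp: indicator_def)
    have "expectation (\<lambda>\<omega>. ?\<phi> (R \<omega>)) = expectation (indicator {\<omega> \<in> space M. r \<le> R \<omega>})"
      by (rule Bochner_Integration.integral_cong) (auto simp: indicator_def)
    then show "expectation (\<lambda>\<omega>. ?\<phi> (R \<omega>)) = prob {\<omega> \<in> space M. r \<le> R \<omega>}" by simp
  qed
  have U: "p / real n * measure (given_mode M mode j (Underlay i))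
        {\<omega> \<in> space M. underlay_capacity n m \<beta> SNR mode j i \<omega> < r} = p / real n - ?U i"
    if i: "i \<in> {1..n}" for i
  proof -
    have "expectation (\<lambda>\<omega>. indicator {\<omega> \<in> space M. mode j \<omega> = Underlay i} \<omega>
            * ?\<phi> (underlay_capacity n m \<beta> SNR mode j i \<omega>)) = ?U i"
      by (subst expectation_underlay_capacity[OF i])
         (auto simp: E underlay_rate_measurable[OF j _ i] prob_underlay_rate_ge[OF j _ i _ r] \<beta> intro!: sum.cong)
    then show ?thesis
      using given_mode_outage[OF underlay_capacity_measurable[OF i], of "Underlay i" \<beta> r]
        prob_mode_pmf[OF p_nonneg p_le_1 i] by simp
  qed
  have "expectation (\<lambda>\<omega>. indicator {\<omega> \<in> space M. mode j \<omega> = Overlay} \<omega>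
            * ?\<phi> (overlay_capacity m \<beta> SNR mode j \<omega>)) = ?O"
    by (subst expectation_overlay_capacity)
       (auto simp: E overlay_rate_measurable[OF j] prob_overlay_rate_ge[OF j _ _ r] \<beta> intro!: sum.cong)
  then have O: "(1 - p) * measure (given_mode M mode j Overlay)
        {\<omega> \<in> space M. overlay_capacity m \<beta> SNR mode j \<omega> < r} = (1 - p) - ?O"
    using given_mode_outage[OF overlay_capacity_measurable, of Overlay \<beta> r]
      prob_mode_pmf(1)[OF p_nonneg p_le_1, of 1 n] n_pos by simp
  have "outage_probability M n m p \<beta> r SNR mode j = (\<Sum>i=1..n. p / real n - ?U i) + ((1 - p) - ?O)"
    unfolding outage_probability_def O sum_distrib_left by (simp only: sum.cong[OF refl U])
  also have "(\<Sum>i=1..n. p / real n - ?U i) = p - (\<Sum>i=1..n. ?U i)"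
    using n_pos by (simp add: sum_subtractf)
  finally show ?thesis by simp
qed

lemma capacity_formula:
  assumes ne: "\<And>i. i \<in> {1..n} \<Longrightarrow> \<gamma> (CUE i) (D2D_Rx j) \<noteq> own_mean j"
  shows "average_capacity M n m p \<beta> SNR mode j =
         (\<Sum>i=1..n. \<Sum>D\<in>Pow ({1..m} - {j}).
            (p / real n) ^ (card D + 1) * Delta \<gamma> i j D
              * (\<beta> * (1 - p / real n) ^ (m - 1 - card D)
                 + (1 - \<beta>) * (p * (1 - 1 / real n)) ^ (m - 1 - card D))
            / (real n * ln 2 * (\<gamma> (CUE i) (D2D_Rx j) / own_mean j - 1)))
         - (1 - \<beta>) * Psi (1 / own_mean j) / ln 2
             * (\<Sum>l=1..m. real ((m - 1) choose (l - 1)) * (p ^ (m - l) * (1 - p) ^ l / real l))"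
    (is "_ = (\<Sum>i=1..n. ?U i) - ?O")
proof -
  have U: "p / real n * integral\<^sup>L (given_mode M mode j (Underlay i))
        (underlay_capacity n m \<beta> SNR mode j i) = ?U i" if i: "i \<in> {1..n}" for i
  proof -
    let ?d = "real n * ln 2 * (\<gamma> (CUE i) (D2D_Rx j) / own_mean j - 1)"
    have I: "integrable M (\<lambda>\<omega>. underlay_rate j i D c \<omega>)"
      "expectation (\<lambda>\<omega>. underlay_rate j i D c \<omega>) = c * (Delta \<gamma> i j D / ?d)"
      if "D \<subseteq> {1..m} - {j}" for D c
      using has_bochner_integral_underlay_rate[OF j that i ne[OF i], of c]
      by (simp_all add: has_bochner_integral_iff)
    have "p / real n * integral\<^sup>L (given_mode M mode j (Underlay i)) (underlay_capacity n m \<beta> SNR mode j i)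
        = expectation (\<lambda>\<omega>. indicator {\<omega> \<in> space M. mode j \<omega> = Underlay i} \<omega>
            * underlay_capacity n m \<beta> SNR mode j i \<omega>)"
      using given_mode_expectation[OF underlay_capacity_measurable[OF i], of "Underlay i" \<beta>]
        prob_mode_pmf[OF p_nonneg p_le_1 i] by simp
    also have "\<dots> = (\<Sum>D\<in>Pow ({1..m} - {j}). (p / real n) ^ (card D + 1) *
      ((p * (1 - 1 / real n)) ^ (m - 1 - card D) * expectation (\<lambda>\<omega>. underlay_rate j i D 1 \<omega>)
       + ((1 - p / real n) ^ (m - 1 - card D) - (p * (1 - 1 / real n)) ^ (m - 1 - card D))
         * expectation (\<lambda>\<omega>. underlay_rate j i D \<beta> \<omega>)))"
      by (rule expectation_underlay_capacity[OF i, where \<phi> = "\<lambda>x. x"]) (simp, rule I(1))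
    also have "\<dots> = ?U i"
    proof (rule sum.cong)
      fix D assume "D \<in> Pow ({1..m} - {j})"
      then have D: "D \<subseteq> {1..m} - {j}" by auto
      show "(p / real n) ^ (card D + 1) *
          ((p * (1 - 1 / real n)) ^ (m - 1 - card D) * expectation (\<lambda>\<omega>. underlay_rate j i D 1 \<omega>)
         + ((1 - p / real n) ^ (m - 1 - card D) - (p * (1 - 1 / real n)) ^ (m - 1 - card D))
           * expectation (\<lambda>\<omega>. underlay_rate j i D \<beta> \<omega>))
        = (p / real n) ^ (card D + 1) * Delta \<gamma> i j D
              * (\<beta> * (1 - p / real n) ^ (m - 1 - card D)
                 + (1 - \<beta>) * (p * (1 - 1 / real n)) ^ (m - 1 - card D)) / ?d"
        \<comment> \<open>The mean rate is linear in the share \<open>c\<close>, so the two weights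
          combine: \<theta>^k + \<beta> ((1 - \<epsilon>)^k - \<theta>^k) = \<beta> (1 -
          \<epsilon>)^k + (1 - \<beta>) \<theta>^k, with k = m - 1 - card D.\<close>
        unfolding I(2)[OF D] times_divide_eq_right[symmetric]
        by (simp only: distrib_left distrib_right left_diff_distrib right_diff_distrib divide_inverse)
           (simp only: algebra_simps)
    qed simp
    finally show ?thesis .
  qed
  have I: "integrable M (\<lambda>\<omega>. overlay_rate j l (1 - \<beta>) \<omega>)"
    "expectation (\<lambda>\<omega>. overlay_rate j l (1 - \<beta>) \<omega>) = (1 - \<beta>) / real l * (- Psi (1 / own_mean j) / ln 2)" for l
    using has_bochner_integral_overlay_rate[OF j, of l "1 - \<beta>"]
    by (simp_all add: has_bochner_integral_iff)
  have "(1 - p) * integral\<^sup>L (given_mode M mode j Overlay) (overlay_capacity m \<beta> SNR mode j)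
      = expectation (\<lambda>\<omega>. indicator {\<omega> \<in> space M. mode j \<omega> = Overlay} \<omega> * overlay_capacity m \<beta> SNR mode j \<omega>)"
    using given_mode_expectation[OF overlay_capacity_measurable, of Overlay \<beta>]
      prob_mode_pmf(1)[OF p_nonneg p_le_1, of 1 n] n_pos by simp
  also have "\<dots> = (\<Sum>l=1..m. real ((m - 1) choose (l - 1)) * p ^ (m - l) * (1 - p) ^ l
        * expectation (\<lambda>\<omega>. overlay_rate j l (1 - \<beta>) \<omega>))"
    by (rule expectation_overlay_capacity[where \<phi> = "\<lambda>x. x"]) (simp, rule I(1))
  also have "\<dots> = - ?O"
    unfolding I(2) sum_distrib_left sum_negf[symmetric]
    by (rule sum.cong) (auto simp: field_simps)
  finally have O: "(1 - p) * integral\<^sup>L (given_mode M mode j Overlay) (overlay_capacity m \<beta> SNR mode j) = - ?O" .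
  have "average_capacity M n m p \<beta> SNR mode j = (\<Sum>i=1..n. ?U i) + - ?O"
    unfolding average_capacity_def O sum_distrib_left by (simp only: sum.cong[OF refl U])
  then show ?thesis by simp
qed

end

end

theorem theorem2:
  fixes M :: "'a measure"
    and n m j :: nat
    and p \<beta> r\<^sub>t \<epsilon> \<theta> \<gamma>\<^sub>j :: real
    and \<gamma> :: "transmitter \<Rightarrow> receiver \<Rightarrow> real"
    and SNR :: "transmitter \<Rightarrow> receiver \<Rightarrow> 'a \<Rightarrow> real"
    and mode :: "nat \<Rightarrow> 'a \<Rightarrow> d2d_mode"
    and D' :: "nat set"
  assumes "d2d_network M n m p \<gamma> SNR mode"
    and "0 \<le> \<beta>" and "\<beta> \<le> 1"
    and "0 \<le> r\<^sub>t"
    and "j \<in> {1..m}"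
    and "\<epsilon> = p / real n"
    and "\<theta> = p * (1 - 1 / real n)"
    and "D' = {1..m} - {j}"
    and "\<gamma>\<^sub>j = \<gamma> (D2D_Tx j) (D2D_Rx j)"
  shows "outage_probability M n m p \<beta> r\<^sub>t SNR mode j =
      1 - (\<Sum>l=1..m. real ((m - 1) choose (l - 1)) * p ^ (m - l) * (1 - p) ^ l
                       * exp_threshold (real l * r\<^sub>t) (1 - \<beta>) \<gamma>\<^sub>j)
        - (\<Sum>i=1..n. \<Sum>D\<in>Pow D'. \<epsilon> ^ (card D + 1) *
             (\<theta> ^ (m - 1 - card D) * Omega n r\<^sub>t \<gamma> i j D 1
              + ((1 - \<epsilon>) ^ (m - 1 - card D) - \<theta> ^ (m - 1 - card D)) * Omega n r\<^sub>t \<gamma> i j D \<beta>))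
    \<and> ((\<forall>i\<in>{1..n}. \<gamma> (CUE i) (D2D_Rx j) \<noteq> \<gamma>\<^sub>j) \<longrightarrow>
       average_capacity M n m p \<beta> SNR mode j =
         (\<Sum>i=1..n. \<Sum>D\<in>Pow D'.
            \<epsilon> ^ (card D + 1) * Delta \<gamma> i j D
              * (\<beta> * (1 - \<epsilon>) ^ (m - 1 - card D) + (1 - \<beta>) * \<theta> ^ (m - 1 - card D))
            / (real n * ln 2 * (\<gamma> (CUE i) (D2D_Rx j) / \<gamma>\<^sub>j - 1)))
         - (1 - \<beta>) * Psi (1 / \<gamma>\<^sub>j) / ln 2
             * (\<Sum>l=1..m. real ((m - 1) choose (l - 1)) * (p ^ (m - l) * (1 - p) ^ l / real l)))"
proof -
  interpret d2d_network M n m p \<gamma> SNR mode by fact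
  show ?thesis
    using outage_formula[OF assms(5) assms(2,3,4)] capacity_formula[OF assms(5), of \<beta>]
    unfolding assms(6-9) by blast
qed

end
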